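(* Let $\mathrm{d}=(d_1,\dots,d_n)$ and $\mathrm{d}'=(d'_1,\dots,d'_n)$ be degree sequences of length $n$, and let $\mathrm{T}_{\mathrm{d}}$ and $\mathrm{T}_{\mathrm{d}'}$ be uniformly random elements of $\mathcal{T}_{\mathrm{d}}$ and $\mathcal{T}_{\mathrm{d}'}$, respectively. If $\mathrm{d}'\prec_2\mathrm{d}$, then $\mathrm{ht}(\mathrm{T}_{\mathrm{d}'})\preceq_{\mathrm{st}}\mathrm{ht}(\mathrm{T}_{\mathrm{d}})$.
   Context: A degree sequence is a sequence of non-negative integers $\mathrm{d}=(d_1,\dots,d_n)$ with $\sum_{i=1}^n d_i=n-1$. $\mathcal{T}_{\mathrm{d}}$ is the set of rooted labeled trees with vertex set $[n]=\{1,\dots,n\}$ in which, for each $i$, vertex $i$ has exactly $d_i$ children. The height $\mathrm{ht}$ of a rooted tree is the maximum graph distance from the root to a vertex. For random variables $X,Y$, $X\preceq_{\mathrm{st}}Y$ means $\mathbf{P}(X\le t)\ge\mathbf{P}(Y\le t)$ for all $t\in\mathbb{R}$. Two degree sequences of length $n$ are equivalent if one is obtained from the other by permuting entries. The partial order $\prec_2$ is defined through the following relation on equivalence classes: for equivalence classes $\mathcal{D},\mathcal{D}'$ of degree sequences of length $n$, say that $\mathcal{D}$ covers $\mathcal{D}'$ if there exist $\mathrm{d}=(d_1,\dots,d_n)\in\mathcal{D}$ and $\mathrm{d}'=(d'_1,\dots,d'_n)\in\mathcal{D}'$ such that $d_1,d_2\ge 1$, $d'_1=d_1+d_2$, $d'_2=0$,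 and $d'_k=d_k$ for $3\le k\le n$. Then $\mathrm{d}'\prec_2\mathrm{d}$ means that there is a finite chain $\mathcal{D}_0,\dots,\mathcal{D}_r$, $r\ge1$, of equivalence classes with $\mathrm{d}\in\mathcal{D}_0$, $\mathrm{d}'\in\mathcal{D}_r$, and $\mathcal{D}_{j-1}$ covering $\mathcal{D}_{j}$ for each $1\le j\le r$, i.e. for each such $j$ there exist $\mathrm{e}=(e_1,\dots,e_n)\in\mathcal{D}_{j-1}$ and $\mathrm{e}'=(e'_1,\dots,e'_n)\in\mathcal{D}_j$ with $e_1,e_2\ge 1$, $e'_1=e_1+e_2$, $e'_2=0$, and $e'_k=e_k$ for $3\le k\le n$. *)

theory Defs
  imports
    "HOL-Probability.Probability_Mass_Function"
    "HOL-Combinatorics.Permutations"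
    "Graph_Theory.Digraph_Component"
begin

section \<open>Degree sequences and the order \<open>\<prec>\<^sub>2\<close>\<close>

text \<open>
  The sequence \<open>(d\<^sub>1, \<dots>, d\<^sub>n)\<close> is a list, so \<open>d\<^sub>i\<close> is \<open>d ! (i - 1)\<close>.  The condition
  that the entries sum to \<open>n - 1\<close> avoids truncated subtraction, and it forces \<open>n \<ge> 1\<close>.
\<close>

definition degree_sequences :: "nat \<Rightarrow> nat list set" where
  "degree_sequences n = {d. length d = n \<and> sum_list d + 1 = n}"

definition perm_equiv :: "nat \<Rightarrow> nat list rel" where
  "perm_equiv n = {(d, d'). d \<in> degree_sequences n \<and> d' \<in> degree_sequences n \<and>
     (\<exists>\<pi>. \<pi> permutes {..<n} \<and> d' = permute_list \<pi> d)}"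

definition degree_classes :: "nat \<Rightarrow> nat list set set" where
  "degree_classes n = degree_sequences n // perm_equiv n"

text \<open>
  The index \<open>1\<close> below is in range: \<open>d ! 0 \<ge> 1\<close> forces \<open>n \<ge> 2\<close> for a degree sequence \<open>d\<close>
  of length \<open>n\<close>.
\<close>

definition covers :: "nat \<Rightarrow> nat list set \<Rightarrow> nat list set \<Rightarrow> bool" where
  "covers n D D' \<longleftrightarrow> D \<in> degree_classes n \<and> D' \<in> degree_classes n \<and>
     (\<exists>d\<in>D. \<exists>d'\<in>D'. d ! 0 \<ge> 1 \<and> d ! 1 \<ge> 1 \<and>
        d' ! 0 = d ! 0 + d ! 1 \<and> d' ! 1 = 0 \<and> (\<forall>k\<in>{2..<n}. d' ! k = d ! k))"

definition prec2 :: "nat \<Rightarrow> nat list \<Rightarrow> nat list \<Rightarrow> bool" where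
  "prec2 n d' d \<longleftrightarrow> (\<exists>D D'. d \<in> D \<and> d' \<in> D' \<and> (covers n)\<^sup>+\<^sup>+ D D')"


section \<open>Rooted labelled trees\<close>

text \<open>
  Finite simple undirected graphs are loop-free symmetric pair digraphs, as in
  \<^locale>\<open>pair_graph\<close>.  The library predicate \<^const>\<open>tree\<close> does not describe undirected
  trees in this representation, because \<^const>\<open>pre_digraph.cycle\<close> also counts the walk
  \<open>a, b, a\<close> along a single edge as a cycle.  Cycles of a simple graph have length at least 3.
\<close>

definition undirected_tree :: "'a pair_pre_digraph \<Rightarrow> bool" where
  "undirected_tree G \<longleftrightarrow> pair_graph G \<and> Digraph_Component.connected (with_proj G) \<and>
     \<not> (\<exists>p. pre_digraph.cycle (with_proj G) p \<and> length p \<ge> 3)"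

definition graph_dist :: "'a pair_pre_digraph \<Rightarrow> 'a \<Rightarrow> 'a \<Rightarrow> nat" where
  "graph_dist G u v = (LEAST k. \<exists>p. pre_digraph.awalk (with_proj G) u p v \<and> length p = k)"

text \<open>A rooted tree is a pair of its root and its underlying undirected tree.\<close>

type_synonym rooted_tree = "nat \<times> nat pair_pre_digraph"

definition children :: "rooted_tree \<Rightarrow> nat \<Rightarrow> nat set" where
  "children T v = {w. (v, w) \<in> parcs (snd T) \<and>
     graph_dist (snd T) (fst T) w = graph_dist (snd T) (fst T) v + 1}"

definition rooted_trees :: "nat list \<Rightarrow> rooted_tree set" where
  "rooted_trees d = {(r, G). undirected_tree G \<and> pverts G = {1..length d} \<and> r \<in> pverts G \<and>
     (\<forall>i\<in>{1..length d}. card (children (r, G) i) = d ! (i - 1))}"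

definition height :: "rooted_tree \<Rightarrow> nat" where
  "height T = Max (graph_dist (snd T) (fst T) ` pverts (snd T))"


section \<open>Stochastic order\<close>

definition stoch_le ::
    "'a measure \<Rightarrow> ('a \<Rightarrow> real) \<Rightarrow> 'b measure \<Rightarrow> ('b \<Rightarrow> real) \<Rightarrow> bool" where
  "stoch_le M X N Y \<longleftrightarrow>
     (\<forall>t. measure M {x \<in> space M. X x \<le> t} \<ge> measure N {y \<in> space N. Y y \<le> t})"

end

theory Submission
  imports Defs
begin

text \<open>
  A rooted tree is encoded by its parent map \<open>p\<close>, and acyclicity by a ranking that increases from child
  to parent.  Let \<open>d'\<close> arise from \<open>d\<close> by giving all children of \<open>j\<close> to \<open>i\<close>.  Trees with degrees \<open>d\<close>
  correspond to pairs of a tree with degrees \<open>d'\<close> and a set of \<open>d i\<close> children of \<open>i\<close>: move the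
  children of the vertex with the shorter subtree to the other one, swapping the two labels if the
  taller subtree is at \<open>j\<close>, and remember the original children of \<open>i\<close>.  The least ranks of the
  old tree still form a ranking of the new one (up to the swap), so the height does not increase.
  Conversely, a pair can be split in two ways, which up to the swap of labels differ by exchanging the
  children of \<open>i\<close> and \<open>j\<close>, and comparing least ranks shows that exactly one of them is the preimage.
  Every tree with degrees \<open>d'\<close> is thus counted \<open>d i + d j choose d i\<close> times, which compares the
  distribution functions of the height.
\<close>

section \<open>Parent maps\<close>

definition ranking :: "('a \<Rightarrow> 'a option) \<Rightarrow> ('a \<Rightarrow> nat) \<Rightarrow> bool" where
  "ranking p f \<longleftrightarrow> (\<forall>w v. p w = Some v \<longrightarrow> f w < f v)"

text \<open>
  A parent map with a ranking is a rooted forest.  The least rank of a vertex is the height of the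
  subtree below it.
\<close>

definition least_rank :: "('a \<Rightarrow> 'a option) \<Rightarrow> 'a \<Rightarrow> nat" where
  "least_rank p v = (LEAST k. \<exists>f. ranking p f \<and> f v = k)"

text \<open>This is how a bound on the height enters: exhibiting a single ranking is enough.
  \<open>rank_bounded_iff_depth\<close> translates it back into depths.\<close>

definition rank_bounded :: "('a \<Rightarrow> 'a option) \<Rightarrow> nat \<Rightarrow> bool" where
  "rank_bounded p h \<longleftrightarrow> (\<exists>f. ranking p f \<and> (\<forall>v. f v \<le> h))"

definition kids :: "('a \<Rightarrow> 'a option) \<Rightarrow> 'a \<Rightarrow> 'a set" where
  "kids p v = {w. p w = Some v}"

text \<open>Neither a root nor connectedness is demanded. If the degrees sum to one less than
  \<open>card V\<close>, counting leaves a single vertex without parent (\<open>ex1_root\<close>),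
  so the forest is a tree.\<close>

definition ptrees :: "'a set \<Rightarrow> ('a \<Rightarrow> nat) \<Rightarrow> ('a \<Rightarrow> 'a option) set" where
  "ptrees V d = {p. dom p \<subseteq> V \<and> ran p \<subseteq> V \<and> (\<exists>f. ranking p f) \<and> (\<forall>v\<in>V. card (kids p v) = d v)}"

definition merge_kids :: "'a \<Rightarrow> 'a \<Rightarrow> ('a \<Rightarrow> 'a option) \<Rightarrow> 'a \<Rightarrow> 'a option" where
  "merge_kids i j p = (\<lambda>w. if p w = Some j then Some i else p w)"

definition split_kids :: "'a \<Rightarrow> 'a \<Rightarrow> 'a set \<Rightarrow> ('a \<Rightarrow> 'a option) \<Rightarrow> 'a \<Rightarrow> 'a option" where
  "split_kids i j C q = (\<lambda>w. if q w = Some i \<and> w \<in> C then Some j else q w)"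

text \<open>Only the values of \<open>p\<close> are transposed: \<open>i\<close> and
  \<open>j\<close> keep their own parents and trade children. Unlike \<open>relabel\<close>, this
  can create a cycle.\<close>

definition exchange_kids :: "'a \<Rightarrow> 'a \<Rightarrow> ('a \<Rightarrow> 'a option) \<Rightarrow> 'a \<Rightarrow> 'a option" where
  "exchange_kids i j p = (\<lambda>w. map_option (Transposition.transpose i j) (p w))"

definition relabel :: "('a \<Rightarrow> 'a) \<Rightarrow> ('a \<Rightarrow> 'a option) \<Rightarrow> 'a \<Rightarrow> 'a option" where
  "relabel \<sigma> p = (\<lambda>w. map_option \<sigma> (p (inv \<sigma> w)))"

lemma rankingD: "ranking p f \<Longrightarrow> p w = Some v \<Longrightarrow> f w < f v"
  by (simp add: ranking_def)

lemma least_rank_le: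
  assumes "ranking p f"
  shows "least_rank p v \<le> f v"
  unfolding least_rank_def by (rule Least_le) (use assms in blast)

text \<open>Minima at different vertices may come from different rankings. But a ranking that
  attains the minimum at the parent already puts the child strictly below it, and the minimum at the
  child is no larger.\<close>

lemma ranking_least_rank:
  assumes "ranking p f"
  shows "ranking p (least_rank p)"
  unfolding ranking_def
proof (intro allI impI)
  fix w v assume wv: "p w = Some v"
  have "\<exists>g. ranking p g \<and> g v = least_rank p v"
    unfolding least_rank_def by (rule LeastI_ex) (use assms in blast)
  then obtain g where "ranking p g" "g v = least_rank p v" by blast
  with wv show "least_rank p w < least_rank p v"
    using least_rank_le[of p g w] rankingD[of p g w v] by simp
qed

lemma rank_bounded_iff:
  assumes "ranking p f"
  shows "rank_bounded p h \<longleftrightarrow> (\<forall>v. least_rank p v \<le> h)"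
  using ranking_least_rank[OF assms] least_rank_le order_trans unfolding rank_bounded_def by metis

section \<open>Relabelling\<close>

lemma ranking_relabel:
  assumes "bij \<sigma>" "ranking p f"
  shows "ranking (relabel \<sigma> p) (f \<circ> inv \<sigma>)"
  using assms by (auto simp: ranking_def relabel_def bij_is_inj)

lemma relabel_inv: "bij \<sigma> \<Longrightarrow> relabel (inv \<sigma>) (relabel \<sigma> p) = p"
  by (rule ext) (simp add: relabel_def inv_inv_eq option.map_comp o_def bij_is_inj option.map_ident)

lemma relabel_inv': "bij \<sigma> \<Longrightarrow> relabel \<sigma> (relabel (inv \<sigma>) p) = p"
  using relabel_inv[of "inv \<sigma>" p] by (simp add: bij_imp_bij_inv inv_inv_eq)

lemma least_rank_relabel:
  assumes "bij \<sigma>" "ranking p f"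
  shows "least_rank (relabel \<sigma> p) (\<sigma> v) = least_rank p v"
proof (rule antisym)
  show "least_rank (relabel \<sigma> p) (\<sigma> v) \<le> least_rank p v"
    using least_rank_le[OF ranking_relabel[OF assms(1) ranking_least_rank[OF assms(2)]], of "\<sigma> v"] assms(1)
    by (simp add: bij_is_inj)
next
  note r = ranking_least_rank[OF ranking_relabel[OF assms]]
  show "least_rank p v \<le> least_rank (relabel \<sigma> p) (\<sigma> v)"
    using least_rank_le[OF ranking_relabel[OF bij_imp_bij_inv[OF assms(1)] r], of v]
    by (simp add: relabel_inv assms(1) inv_inv_eq)
qed

lemma kids_relabel:
  assumes "bij \<sigma>"
  shows "kids (relabel \<sigma> p) (\<sigma> v) = \<sigma> ` kids p v"
proof -
  have "w \<in> kids (relabel \<sigma> p) (\<sigma> v) \<longleftrightarrow> inv \<sigma> w \<in> kids p v" for w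
    using assms by (auto simp: kids_def relabel_def bij_is_inj inj_eq)
  then show ?thesis using bij_image_Collect_eq[OF assms, of "\<lambda>w. w \<in> kids p v"] by auto
qed

lemma rank_bounded_relabel:
  assumes "bij \<sigma>"
  shows "rank_bounded (relabel \<sigma> p) h \<longleftrightarrow> rank_bounded p h"
proof -
  have "rank_bounded (relabel \<tau> q) h" if "bij \<tau>" "rank_bounded q h" for \<tau> and q :: "'a \<Rightarrow> 'a option"
    using that(2) ranking_relabel[OF that(1)] unfolding rank_bounded_def by fastforce
  from this[of \<sigma> p] this[of "inv \<sigma>" "relabel \<sigma> p"] show ?thesis
    using assms by (auto simp: relabel_inv bij_imp_bij_inv)
qed

lemma relabel_in_ptrees:
  assumes \<sigma>: "\<sigma> permutes V" and p: "p \<in> ptrees V (d \<circ> \<sigma>)"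
  shows "relabel \<sigma> p \<in> ptrees V d"
proof -
  have b: "bij \<sigma>" using \<sigma> by (rule permutes_bij)
  have "card (kids (relabel \<sigma> p) v) = d v" if "v \<in> V" for v
  proof -
    have "inv \<sigma> v \<in> V" using that \<sigma> by (metis permutes_inv permutes_in_image)
    moreover have "v = \<sigma> (inv \<sigma> v)" using \<sigma> by (simp add: permutes_inverses)
    ultimately show ?thesis
      using p kids_relabel[OF b, of p "inv \<sigma> v"] b
      by (simp add: ptrees_def card_image bij_is_inj inj_on_subset[of \<sigma> UNIV])
  qed
  moreover have "dom (relabel \<sigma> p) \<subseteq> V"
  proof
    fix w assume "w \<in> dom (relabel \<sigma> p)"
    then have "inv \<sigma> w \<in> dom p" by (auto simp: relabel_def)
    then have "inv \<sigma> w \<in> V" using p by (auto simp: ptrees_def)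
    then show "w \<in> V" using \<sigma> by (metis permutes_inv permutes_in_image)
  qed
  moreover have "ran (relabel \<sigma> p) \<subseteq> V"
  proof
    fix v assume "v \<in> ran (relabel \<sigma> p)"
    then obtain u where "u \<in> ran p" "v = \<sigma> u" by (auto simp: relabel_def ran_def)
    moreover have "ran p \<subseteq> V" using p by (simp add: ptrees_def)
    ultimately show "v \<in> V" using \<sigma> by (auto simp: permutes_in_image)
  qed
  moreover obtain f where "ranking p f" using p by (auto simp: ptrees_def)
  then have "\<exists>f. ranking (relabel \<sigma> p) f" using ranking_relabel[OF b] by blast
  ultimately show ?thesis by (simp add: ptrees_def)
qed

lemma bij_betw_relabel:
  assumes \<sigma>: "\<sigma> permutes V"
  shows "bij_betw (relabel \<sigma>) (ptrees V (d \<circ> \<sigma>)) (ptrees V d)"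
proof (rule bij_betwI[where g = "relabel (inv \<sigma>)"])
  show "relabel \<sigma> \<in> ptrees V (d \<circ> \<sigma>) \<rightarrow> ptrees V d" using relabel_in_ptrees[OF \<sigma>] by auto
  have "(d \<circ> \<sigma>) \<circ> inv \<sigma> = d" using \<sigma> by (simp add: o_assoc[symmetric] permutes_inv_o)
  then show "relabel (inv \<sigma>) \<in> ptrees V d \<rightarrow> ptrees V (d \<circ> \<sigma>)"
    using relabel_in_ptrees[OF permutes_inv[OF \<sigma>], of _ "d \<circ> \<sigma>"] by auto
qed (use relabel_inv relabel_inv' permutes_bij[OF \<sigma>] in auto)

section \<open>Merging and splitting\<close>

text \<open>Only arcs into \<open>j\<close> are redirected, and their sources \<open>w\<close>
  satisfy \<open>f w < f j \<le> f i\<close>. As \<open>f\<close> itself is kept, every bound on it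
  carries over.\<close>

lemma ranking_merge:
  assumes "ranking p f" "f j \<le> f i"
  shows "ranking (merge_kids i j p) f"
  using assms by (fastforce simp: ranking_def merge_kids_def)

lemma kids_merge:
  assumes "i \<noteq> j"
  shows "kids (merge_kids i j p) i = kids p i \<union> kids p j" "kids (merge_kids i j p) j = {}"
    "v \<noteq> i \<Longrightarrow> v \<noteq> j \<Longrightarrow> kids (merge_kids i j p) v = kids p v"
  using assms by (auto simp: kids_def merge_kids_def)

lemma split_merge: "split_kids i j (kids p j) (merge_kids i j p) = p"
  by (rule ext) (auto simp: split_kids_def merge_kids_def kids_def)

lemma merge_split: "kids q j = {} \<Longrightarrow> merge_kids i j (split_kids i j C q) = q"
  by (rule ext) (auto simp: split_kids_def merge_kids_def kids_def)

lemma kids_split: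
  assumes "i \<noteq> j" "kids q j = {}" "C \<subseteq> kids q i"
  shows "kids (split_kids i j C q) i = kids q i - C" "kids (split_kids i j C q) j = C"
    "v \<noteq> i \<Longrightarrow> v \<noteq> j \<Longrightarrow> kids (split_kids i j C q) v = kids q v"
  using assms by (auto simp: kids_def split_kids_def)

section \<open>Trading the children of two vertices\<close>

lemma exchange_exchange: "exchange_kids i j (exchange_kids i j p) = p"
  by (rule ext) (simp add: exchange_kids_def option.map_comp o_def option.map_ident)

lemma exchange_commute: "exchange_kids i j p = exchange_kids j i p"
  by (simp add: exchange_kids_def Transposition.transpose_commute)

text \<open>Handing \<open>C\<close> or its complement to \<open>j\<close> divides the children of
  \<open>i\<close> into the same two blocks; only the recipients differ.\<close>

lemma exchange_split:
  assumes "kids q j = {}" "i \<noteq> j"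
  shows "exchange_kids i j (split_kids i j C q) = split_kids i j (kids q i - C) q"
proof (rule ext)
  fix w
  have "q w \<noteq> Some j" using assms(1) by (auto simp: kids_def)
  then show "exchange_kids i j (split_kids i j C q) w = split_kids i j (kids q i - C) q w"
    using assms(2) by (cases "q w") (auto simp: exchange_kids_def split_kids_def kids_def Transposition.transpose_def)
qed

lemma exchange_cases:
  assumes "exchange_kids i j p w = Some v"
  obtains "v = i" "p w = Some j" | "v = j" "p w = Some i" | "v \<noteq> i" "v \<noteq> j" "p w = Some v"
  using assms by (auto simp: exchange_kids_def Transposition.transpose_def split: if_splits)

text \<open>The vertices of rank below \<open>least_rank p j\<close> have the same subtrees in both maps.\<close>

lemma least_rank_exchange_le:
  assumes p: "ranking p f" and p': "ranking (exchange_kids i j p) f'"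
    and le: "least_rank p j \<le> least_rank p i" and ij: "i \<noteq> j"
  shows "least_rank (exchange_kids i j p) i \<le> least_rank p j"
proof -
  let ?s = "least_rank p" and ?t = "least_rank (exchange_kids i j p)"
  note s = rankingD[OF ranking_least_rank[OF p]] and t = rankingD[OF ranking_least_rank[OF p']]
  \<comment> \<open>\<open>g\<close> keeps the old ranks below \<open>?s j\<close>, puts
    \<open>i\<close> at \<open>?s j\<close>, and lifts all other vertices above that, where
    \<open>?t\<close> orders them. The new children of \<open>i\<close> are the old ones of
    \<open>j\<close>, so they rank below \<open>?s j\<close>.\<close>
  define g where "g v = (if v = i then ?s j else if ?s v < ?s j then ?s v else ?s j + 1 + ?t v)" for v
  have "ranking (exchange_kids i j p) g"
    unfolding ranking_def
  proof (intro allI impI)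
    fix w v assume e: "exchange_kids i j p w = Some v"
    note tt = t[OF e]
    from e show "g w < g v"
    proof (cases rule: exchange_cases)
      case 1
      then have "?s w < ?s j" using s by blast
      with 1 le show ?thesis by (auto simp: g_def)
    next
      case 2
      with ij le tt show ?thesis by (auto simp: g_def)
    next
      case 3
      with s[OF 3(3)] le tt show ?thesis by (auto simp: g_def)
    qed
  qed
  from least_rank_le[OF this, of i] show ?thesis by (simp add: g_def)
qed

text \<open>Exchanging children reverses the order of the two subtree heights. So if both splittings
  of a pair are acyclic, the weak inequality for one and the strict one for the other exclude each
  other and cannot both fail.\<close>

lemma least_rank_exchange_less:
  assumes p: "ranking p f" and p': "ranking (exchange_kids i j p) f'" and ij: "i \<noteq> j"
  shows "least_rank (exchange_kids i j p) j < least_rank (exchange_kids i j p) i \<longleftrightarrow>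
    least_rank p i < least_rank p j"
proof -
  let ?s = "least_rank p" and ?t = "least_rank (exchange_kids i j p)"
  \<comment> \<open>The preceding bound is used for both maps and for both roles of \<open>i\<close>
    and \<open>j\<close>.\<close>
  have 1: "?s j \<le> ?s i \<Longrightarrow> ?t i \<le> ?s j"
    using least_rank_exchange_le[OF p p' _ ij] .
  have 2: "?s i \<le> ?s j \<Longrightarrow> ?t j \<le> ?s i"
    using least_rank_exchange_le[of p f j i f'] p p' ij by (simp add: exchange_commute)
  have 3: "?t j \<le> ?t i \<Longrightarrow> ?s i \<le> ?t j"
    using least_rank_exchange_le[OF p' _ _ ij, of f] p by (simp add: exchange_exchange)
  have 4: "?t i \<le> ?t j \<Longrightarrow> ?s j \<le> ?t i"
    using least_rank_exchange_le[of "exchange_kids i j p" f' j i f] p p' ij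
    by (simp add: exchange_commute[of j i] exchange_exchange)
  show ?thesis using 1 2 3 4 by linarith
qed

text \<open>Giving the children of \<open>i\<close> to the vertex \<open>j\<close> of no smaller
  rank is harmless. Giving those of \<open>j\<close> to \<open>i\<close> closes a cycle only if
  \<open>i\<close> lies below \<open>j\<close>, and then the merged map would have a cycle
  too.\<close>

lemma ranking_exchange:
  assumes p: "ranking p s" and le: "s i \<le> s j" and q: "ranking (merge_kids i j p) g" and ij: "i \<noteq> j"
  shows "\<exists>f. ranking (exchange_kids i j p) f"
proof -
  \<comment> \<open>In the merged map all children of \<open>i\<close> and \<open>j\<close> lie
    below \<open>i\<close>, so they escape the lift by \<open>s j\<close> that \<open>i\<close>
    receives. On the other arcs the lift is monotone because \<open>g\<close> increases.\<close>
  define f where "f v = (if g i \<le> g v then s v + s j else s v)" for v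
  have "ranking (exchange_kids i j p) f"
    unfolding ranking_def
  proof (intro allI impI)
    fix w v assume "exchange_kids i j p w = Some v"
    then show "f w < f v"
    proof (cases rule: exchange_cases)
      case 1
      then have "g w < g i" by (intro rankingD[OF q]) (simp add: merge_kids_def)
      with rankingD[OF p 1(2)] 1 show ?thesis by (simp add: f_def)
    next
      case 2
      then have "g w < g i" using ij by (intro rankingD[OF q]) (simp add: merge_kids_def)
      with rankingD[OF p 2(2)] 2 le show ?thesis by (simp add: f_def)
    next
      case 3
      then have "g w < g v" by (intro rankingD[OF q]) (simp add: merge_kids_def)
      with rankingD[OF p 3(3)] show ?thesis by (simp add: f_def)
    qed
  qed
  then show ?thesis by blast
qed

text \<open>The new arcs lead from \<open>C\<close>, outside the parent-closed set \<open>U\<close>,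
  to \<open>j\<close> inside it. Lifting \<open>U\<close> by \<open>g i\<close> makes them increase,
  since members of \<open>C\<close> that move have rank below \<open>g i\<close>.\<close>

lemma ranking_split:
  assumes q: "ranking q g" and U: "\<And>w v. q w = Some v \<Longrightarrow> w \<in> U \<Longrightarrow> v \<in> U" "j \<in> U" "C \<inter> U = {}"
  shows "\<exists>f. ranking (split_kids i j C q) f"
proof -
  define f where "f v = (if v \<in> U then g v + g i else g v)" for v
  have "ranking (split_kids i j C q) f"
    unfolding ranking_def
  proof (intro allI impI)
    fix w v assume e: "split_kids i j C q w = Some v"
    show "f w < f v"
    proof (cases "q w = Some i \<and> w \<in> C")
      case True
      then show ?thesis using e U rankingD[OF q, of w i] by (auto simp: f_def split_kids_def)
    next
      case False
      then have "q w = Some v" using e by (auto simp: split_kids_def)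
      then show ?thesis using U(1)[of w v] rankingD[OF q, of w v] by (auto simp: f_def)
    qed
  qed
  then show ?thesis by blast
qed

text \<open>The ancestors of \<open>j\<close> form a chain, so they cannot meet both \<open>C\<close> and its complement among the
  children of \<open>i\<close>.\<close>

lemma ranking_split_or:
  assumes q: "ranking q g" and C: "C \<subseteq> kids q i"
  shows "(\<exists>f. ranking (split_kids i j C q) f) \<or> (\<exists>f. ranking (split_kids i j (kids q i - C) q) f)"
proof -
  define R where "R = {(w, v). q w = Some v}"
  define U where "U = {v. (j, v) \<in> R\<^sup>*}"
  have sv: "single_valued R" by (auto simp: R_def single_valued_def)
  have up: "g v \<le> g w" if "(v, w) \<in> R\<^sup>*" for v w
    using that by induction (auto simp: R_def dest: rankingD[OF q])
  \<comment> \<open>A walk towards the root from one child of \<open>i\<close> to another would pass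
    through \<open>i\<close>, which has larger rank than both.\<close>
  have no: "(b, s) \<notin> R\<^sup>*" if "b \<in> kids q i" "s \<in> kids q i" "b \<noteq> s" for b s
  proof
    assume "(b, s) \<in> R\<^sup>*"
    with that(3) obtain c where "(b, c) \<in> R" "(c, s) \<in> R\<^sup>*" by (meson converse_rtranclE)
    moreover have "c = i" using \<open>(b, c) \<in> R\<close> that(1) by (auto simp: R_def kids_def)
    ultimately have "g i \<le> g s" using up by blast
    moreover have "g s < g i" using that(2) rankingD[OF q] by (auto simp: kids_def)
    ultimately show False by simp
  qed
  have "C \<inter> U = {} \<or> (kids q i - C) \<inter> U = {}"
  proof (rule ccontr)
    assume "\<not> ?thesis"
    then obtain b s where "b \<in> C" "s \<in> kids q i - C" "(j, b) \<in> R\<^sup>*" "(j, s) \<in> R\<^sup>*"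
      by (auto simp: U_def)
    then show False using single_valued_confluent[OF sv, of j b s] no C by blast
  qed
  moreover have "w \<in> U \<Longrightarrow> v \<in> U" if "q w = Some v" for w v
    using that unfolding U_def R_def by (auto intro: rtrancl_into_rtrancl)
  moreover have "j \<in> U" by (simp add: U_def)
  ultimately show ?thesis
    using ranking_split[OF q, of U j C i] ranking_split[OF q, of U j "kids q i - C" i] by blast
qed

text \<open>Start from a splitting that is acyclic. If its order at \<open>i\<close> and
  \<open>j\<close> is the wrong one, \<open>ranking_exchange\<close> makes the other splitting
  acyclic as well, and that one has the right order. This yields surjectivity of
  \<open>merge_heavy\<close>.\<close>

lemma ranking_split_exchange:
  assumes q: "ranking q g" and ij: "i \<noteq> j" and "kids q j = {}" and S: "S \<subseteq> kids q i"
  obtains (stay) f where "ranking (split_kids i j (kids q i - S) q) f"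
      "least_rank (split_kids i j (kids q i - S) q) j \<le> least_rank (split_kids i j (kids q i - S) q) i"
    | (swap) f where "ranking (split_kids i j S q) f"
      "least_rank (split_kids i j S q) j < least_rank (split_kids i j S q) i"
proof -
  let ?B = "split_kids i j (kids q i - S) q" and ?S = "split_kids i j S q"
  have eB: "?B = exchange_kids i j ?S" using assms by (simp add: exchange_split)
  have eS: "?S = exchange_kids i j ?B" by (simp add: eB exchange_exchange)
  have mB: "merge_kids i j ?B = q" and mS: "merge_kids i j ?S = q" using assms by (simp_all add: merge_split)
  have "\<exists>f. ranking ?B f \<and> least_rank ?B j \<le> least_rank ?B i \<or>
    ranking ?S f \<and> least_rank ?S j < least_rank ?S i"
  proof (cases "\<exists>f. ranking ?B f")
    case True
    then obtain f where f: "ranking ?B f" by blast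
    show ?thesis
    proof (cases "least_rank ?B j \<le> least_rank ?B i")
      case False
      then obtain f' where f': "ranking ?S f'"
        using ranking_exchange[OF ranking_least_rank[OF f] _ _ ij] q by (metis mB eS nat_le_linear)
      then show ?thesis using False least_rank_exchange_less[OF f _ ij, of f'] eS by auto
    qed (use f in blast)
  next
    case False
    then obtain f where f: "ranking ?S f" using ranking_split_or[OF q S] by blast
    show ?thesis
    proof (cases "least_rank ?S j < least_rank ?S i")
      case False
      \<comment> \<open>The wrong order in \<open>?S\<close> would make its exchange
        \<open>?B\<close> acyclic, contrary to the outer case.\<close>
      then show ?thesis
        using ranking_exchange[OF ranking_least_rank[OF f] _ _ ij] q \<open>\<nexists>f. ranking ?B f\<close>
        by (metis mS eB not_le_imp_less)
    qed (use f in blast)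
  qed
  then show ?thesis using that by blast
qed

section \<open>The bijection\<close>

text \<open>In the second branch the swap of labels puts the taller subtree at \<open>i\<close>. The
  original children of \<open>i\<close> are then those of \<open>j\<close> in \<open>r\<close>, so
  the recorded set has \<open>d i\<close> elements in either branch.\<close>

definition merge_heavy :: "'a \<Rightarrow> 'a \<Rightarrow> ('a \<Rightarrow> 'a option) \<Rightarrow> ('a \<Rightarrow> 'a option) \<times> 'a set" where
  "merge_heavy i j p = (if least_rank p j \<le> least_rank p i then (merge_kids i j p, kids p i)
     else (let r = relabel (Transposition.transpose i j) p in (merge_kids i j r, kids r j)))"

lemma finite_kids:
  assumes "finite V" "p \<in> ptrees V d"
  shows "finite (kids p v)"
proof -
  have "kids p v \<subseteq> V" using assms(2) by (auto simp: ptrees_def kids_def)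
  then show ?thesis using assms(1) finite_subset by blast
qed

lemma merge_in_ptrees:
  assumes "finite V" "i \<in> V" "j \<in> V" "i \<noteq> j" and p: "p \<in> ptrees V d"
    and f: "ranking p f" "f j \<le> f i"
  shows "merge_kids i j p \<in> ptrees V (d(i := d i + d j, j := 0))"
proof -
  have "card (kids p i \<union> kids p j) = d i + d j"
    using finite_kids[OF \<open>finite V\<close> p] p \<open>i \<in> V\<close> \<open>j \<in> V\<close> \<open>i \<noteq> j\<close>
    by (subst card_Un_disjoint) (auto simp: ptrees_def kids_def)
  then have "card (kids (merge_kids i j p) v) = (d(i := d i + d j, j := 0)) v" if "v \<in> V" for v
    using p that kids_merge[OF \<open>i \<noteq> j\<close>, where p = p] by (cases "v = i"; cases "v = j") (auto simp: ptrees_def)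
  moreover have "dom (merge_kids i j p) \<subseteq> V" "ran (merge_kids i j p) \<subseteq> V"
    using p \<open>i \<in> V\<close> by (auto simp: ptrees_def merge_kids_def dom_def ran_def split: if_splits)
  ultimately show ?thesis using ranking_merge[OF f] by (auto simp: ptrees_def)
qed

lemma split_in_ptrees:
  assumes "finite V" "i \<in> V" "j \<in> V" "i \<noteq> j" and q: "q \<in> ptrees V (d(i := d i + d j, j := 0))"
    and C: "C \<subseteq> kids q i" "card C = d j" and f: "ranking (split_kids i j C q) f"
  shows "split_kids i j C q \<in> ptrees V d"
proof -
  have e: "kids q j = {}" "card (kids q i) = d i + d j"
    using q assms(2-4) finite_kids[OF \<open>finite V\<close> q] by (auto simp: ptrees_def)
  have "finite C" using C(1) finite_kids[OF \<open>finite V\<close> q] finite_subset by blast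
  then have "card (kids (split_kids i j C q) v) = d v" if "v \<in> V" for v
    using q that C e kids_split[OF \<open>i \<noteq> j\<close> e(1) C(1)]
    by (cases "v = i"; cases "v = j") (simp_all add: ptrees_def card_Diff_subset)
  moreover have "dom (split_kids i j C q) \<subseteq> V" "ran (split_kids i j C q) \<subseteq> V"
    using q \<open>j \<in> V\<close> by (auto simp: ptrees_def split_kids_def dom_def ran_def split: if_splits)
  ultimately show ?thesis using f by (auto simp: ptrees_def)
qed

lemma relabel_transpose:
  "relabel (Transposition.transpose i j) (relabel (Transposition.transpose i j) p) = p"
  using relabel_inv[of "Transposition.transpose i j" p] by simp

lemma least_rank_relabel_transpose:
  assumes "ranking p f"
  shows "least_rank (relabel (Transposition.transpose i j) p) i = least_rank p j"
    "least_rank (relabel (Transposition.transpose i j) p) j = least_rank p i"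
  using least_rank_relabel[of "Transposition.transpose i j" p f, OF bij_transpose assms, of j]
    least_rank_relabel[of "Transposition.transpose i j" p f, OF bij_transpose assms, of i]
  by simp_all

lemma bij_betw_merge_heavy:
  fixes d :: "'a \<Rightarrow> nat"
  assumes V: "finite V" "i \<in> V" "j \<in> V" and ij: "i \<noteq> j"
  defines "e \<equiv> d(i := d i + d j, j := 0)"
  shows "bij_betw (merge_heavy i j) (ptrees V d)
    (SIGMA q:ptrees V e. {S. S \<subseteq> kids q i \<and> card S = d i})" (is "bij_betw _ _ ?Y")
proof -
  let ?\<tau> = "Transposition.transpose i j"
  \<comment> \<open>These are the degrees after the swap of labels. They merge to the same
    \<open>e\<close>, so both branches have the same target.\<close>
  define d\<tau> where "d\<tau> = d \<circ> ?\<tau>"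
  have dd: "d\<tau> \<circ> ?\<tau> = d" by (simp add: d\<tau>_def o_assoc[symmetric])
  have e': "e = d\<tau>(i := d\<tau> i + d\<tau> j, j := 0)"
    using ij by (auto simp: e_def d\<tau>_def Transposition.transpose_def fun_eq_iff)
  have \<tau>: "?\<tau> permutes V" using V(2,3) by (rule permutes_swap_id)
  have rel: "relabel ?\<tau> p \<in> ptrees V d\<tau>" if "p \<in> ptrees V d" for p
    using relabel_in_ptrees[OF \<tau>, of p d\<tau>] that dd by simp
  \<comment> \<open>In the first branch \<open>S\<close> stays at \<open>i\<close>, so
    \<open>p\<close> is recovered by splitting off its complement; in the second branch, treated
    next, \<open>S\<close> itself goes to \<open>j\<close> and the swapped \<open>p\<close> is
    recovered.\<close>
  have le: "least_rank p j \<le> least_rank p i \<Longrightarrow> merge_heavy i j p = (q, S) \<Longrightarrow>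
      p = split_kids i j (kids q i - S) q \<and> q \<in> ptrees V e \<and> S \<subseteq> kids q i \<and> card S = d i"
    if p: "p \<in> ptrees V d" for p q S
  proof -
    assume *: "least_rank p j \<le> least_rank p i" and "merge_heavy i j p = (q, S)"
    then have q: "q = merge_kids i j p" "S = kids p i" by (auto simp: merge_heavy_def)
    obtain f where f: "ranking p f" using p by (auto simp: ptrees_def)
    have "kids q i - S = kids p j" using ij by (auto simp: q kids_merge) (auto simp: kids_def)
    then show ?thesis
      using merge_in_ptrees[OF V ij p ranking_least_rank[OF f] *] p V(2) ij
      by (simp add: q split_merge kids_merge e_def) (simp add: ptrees_def)
  qed
  have gt: "\<not> least_rank p j \<le> least_rank p i \<Longrightarrow> merge_heavy i j p = (q, S) \<Longrightarrow>
      relabel ?\<tau> p = split_kids i j S q \<and> q \<in> ptrees V e \<and> S \<subseteq> kids q i \<and> card S = d i \<and>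
      least_rank (split_kids i j S q) j < least_rank (split_kids i j S q) i"
    if p: "p \<in> ptrees V d" for p q S
  proof -
    assume *: "\<not> least_rank p j \<le> least_rank p i" and "merge_heavy i j p = (q, S)"
    then have q: "q = merge_kids i j (relabel ?\<tau> p)" "S = kids (relabel ?\<tau> p) j"
      by (auto simp: merge_heavy_def Let_def)
    obtain f where f: "ranking p f" using p by (auto simp: ptrees_def)
    then obtain f' where f': "ranking (relabel ?\<tau> p) f'" using ranking_relabel[of ?\<tau>] by auto
    note rk = least_rank_relabel_transpose[OF f, of i j]
    have "card S = d\<tau> j" using rel[OF p] V(3) by (simp add: q ptrees_def)
    then have "card S = d i" by (simp add: d\<tau>_def)
    then show ?thesis
      using merge_in_ptrees[OF V ij rel[OF p] ranking_least_rank[OF f']] * ij rk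
      by (simp add: q split_merge kids_merge e')
  qed
  have inj: "inj_on (merge_heavy i j) (ptrees V d)"
  proof (rule inj_onI)
    \<comment> \<open>Preimages from different branches would give two acyclic splittings related by
      an exchange, both in the order of their branch, against
      \<open>least_rank_exchange_less\<close>.\<close>
    have mixed: False if p: "p \<in> ptrees V d" "p' \<in> ptrees V d" "merge_heavy i j p = merge_heavy i j p'"
      "least_rank p j \<le> least_rank p i" "\<not> least_rank p' j \<le> least_rank p' i" for p p'
    proof -
      obtain q S where qS: "merge_heavy i j p = (q, S)" by fastforce
      note 1 = le[OF p(1,4) qS] and 2 = gt[OF p(2,5) qS[unfolded p(3)]]
      have "kids q j = {}" using 1 V ij finite_kids[OF V(1), of q e j] by (auto simp: ptrees_def e_def)
      then have ex: "exchange_kids i j p = relabel ?\<tau> p'"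
        using 1 2 ij by (simp add: exchange_split double_diff)
      obtain f f' where f: "ranking p f" "ranking p' f'" using p by (auto simp: ptrees_def)
      have "ranking (relabel ?\<tau> p') (f' \<circ> inv ?\<tau>)" using f(2) by (intro ranking_relabel) simp_all
      then show False
        using least_rank_exchange_less[OF f(1) _ ij, of "f' \<circ> inv ?\<tau>"] ex 2 p(4) by simp
    qed
    fix p p' assume p: "p \<in> ptrees V d" "p' \<in> ptrees V d" and eq: "merge_heavy i j p = merge_heavy i j p'"
    obtain q S where qS: "merge_heavy i j p = (q, S)" by fastforce
    note qS' = qS[unfolded eq]
    consider "least_rank p j \<le> least_rank p i" "least_rank p' j \<le> least_rank p' i"
      | "\<not> least_rank p j \<le> least_rank p i" "\<not> least_rank p' j \<le> least_rank p' i"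
      using mixed[OF p eq] mixed[OF p(2,1) eq[symmetric]] by blast
    then show "p = p'"
    proof cases
      case 1
      then show ?thesis using le[OF p(1) _ qS] le[OF p(2) _ qS'] by simp
    next
      case 2
      then have "relabel ?\<tau> p = relabel ?\<tau> p'" using gt[OF p(1) _ qS] gt[OF p(2) _ qS'] by simp
      then show ?thesis by (metis relabel_transpose)
    qed
  qed
  have "merge_heavy i j p \<in> ?Y" if "p \<in> ptrees V d" for p
  proof -
    obtain q S where qS: "merge_heavy i j p = (q, S)" by fastforce
    show ?thesis
      using le[OF that _ qS] gt[OF that _ qS] unfolding qS by blast
  qed
  moreover have "(q, S) \<in> merge_heavy i j ` ptrees V d"
    if q: "q \<in> ptrees V e" and S: "S \<subseteq> kids q i" "card S = d i" for q S
  proof -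
    obtain g where g: "ranking q g" using q by (auto simp: ptrees_def)
    have kj: "kids q j = {}" and ki: "card (kids q i) = d i + d j"
      using q V ij finite_kids[OF V(1) q] by (auto simp: ptrees_def e_def)
    from g ij kj S(1) show ?thesis
    proof (cases rule: ranking_split_exchange)
      case (stay f)
      let ?p = "split_kids i j (kids q i - S) q"
      have "finite S" using S(1) finite_kids[OF V(1) q] finite_subset by blast
      then have "card (kids q i - S) = d j" using S ki by (simp add: card_Diff_subset)
      then have "?p \<in> ptrees V d" using split_in_ptrees[OF V ij q[unfolded e_def] _ _ stay(1)] by simp
      moreover have "merge_heavy i j ?p = (q, S)"
        using stay(2) kids_split[OF ij kj, of "kids q i - S"] S kj
        by (simp add: merge_heavy_def merge_split double_diff)
      ultimately show ?thesis by (metis image_eqI)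
    next
      case (swap f)
      let ?r = "split_kids i j S q"
      have r: "?r \<in> ptrees V d\<tau>"
        using split_in_ptrees[OF V ij q[unfolded e'] S(1) _ swap(1)] S(2) by (simp add: d\<tau>_def)
      then have "relabel ?\<tau> ?r \<in> ptrees V d" using relabel_in_ptrees[OF \<tau>, of _ d] by (simp add: d\<tau>_def)
      moreover have "merge_heavy i j (relabel ?\<tau> ?r) = (q, S)"
        using swap(2) least_rank_relabel_transpose[OF swap(1), of i j] kids_split[OF ij kj S(1)] kj
        by (simp add: merge_heavy_def relabel_transpose merge_split)
      ultimately show ?thesis by (metis image_eqI)
    qed
  qed
  ultimately have "merge_heavy i j ` ptrees V d = ?Y" by blast
  with inj show ?thesis by (simp add: bij_betw_def)
qed

text \<open>The least ranks of \<open>p\<close>, or of its swapped version, are at most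
  \<open>h\<close> and still rank the merged map by \<open>ranking_merge\<close>.\<close>

lemma rank_bounded_merge_heavy:
  assumes p: "ranking p f" and "rank_bounded p h"
  shows "rank_bounded (fst (merge_heavy i j p)) h"
proof -
  note rank_bounded = iffD1[OF rank_bounded_iff[OF p] assms(2)]
  show ?thesis
  proof (cases "least_rank p j \<le> least_rank p i")
    case True
    then show ?thesis
      using ranking_merge[OF ranking_least_rank[OF p] True] rank_bounded by (auto simp: rank_bounded_def merge_heavy_def)
  next
    case False
    let ?r = "relabel (Transposition.transpose i j) p"
    have r: "ranking ?r (f \<circ> inv (Transposition.transpose i j))" using p by (intro ranking_relabel) simp_all
    have "rank_bounded ?r h" using assms(2) by (simp add: rank_bounded_relabel)
    then have "least_rank ?r v \<le> h" for v using rank_bounded_iff[OF r] by blast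
    moreover have "ranking (merge_kids i j ?r) (least_rank ?r)"
      using False least_rank_relabel_transpose[OF p, of i j]
      by (intro ranking_merge ranking_least_rank[OF r]) simp
    ultimately show ?thesis using False by (auto simp: rank_bounded_def merge_heavy_def Let_def)
  qed
qed

section \<open>Counting parent maps\<close>

lemma finite_ptrees:
  assumes "finite V"
  shows "finite (ptrees V d)"
proof (rule finite_subset)
  show "ptrees V d \<subseteq> (\<Union>A\<in>Pow V. {m. dom m = A \<and> ran m \<subseteq> V})" by (auto simp: ptrees_def)
  show "finite (\<Union>A\<in>Pow V. {m. dom m = A \<and> ran m \<subseteq> V})"
    using assms by (intro finite_UN_I finite_set_of_finite_maps) (auto dest: finite_subset)
qed

text \<open>Each \<open>q\<close> is paired with binomially many sets \<open>S\<close>. For bounded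
  maps only an inequality results, since a merged map can be bounded although its preimage is
  not.\<close>

lemma card_ptrees_merge:
  fixes d :: "'a \<Rightarrow> nat"
  assumes V: "finite V" "i \<in> V" "j \<in> V" and ij: "i \<noteq> j"
  defines "e \<equiv> d(i := d i + d j, j := 0)"
  shows "card (ptrees V d) = (d i + d j choose d i) * card (ptrees V e)"
    and "card {p \<in> ptrees V d. rank_bounded p h} \<le> (d i + d j choose d i) * card {q \<in> ptrees V e. rank_bounded q h}"
proof -
  let ?c = "d i + d j choose d i" and ?S = "\<lambda>q. {S. S \<subseteq> kids q i \<and> card S = d i}"
  have fin: "finite (kids q i)" if "q \<in> ptrees V e" for q using finite_kids[OF V(1) that] .
  have cS: "card (?S q) = ?c" if "q \<in> ptrees V e" for q
  proof -
    have "card (kids q i) = d i + d j" using that V ij by (simp add: ptrees_def e_def)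
    then show ?thesis using n_subsets[OF fin[OF that], of "d i"] by simp
  qed
  have cY: "card (Sigma A ?S) = ?c * card A" if A: "A \<subseteq> ptrees V e" for A
  proof -
    have "finite A" using A finite_ptrees[OF V(1)] finite_subset by blast
    moreover have "\<forall>q\<in>A. finite (?S q)" using A fin by auto
    ultimately have "card (Sigma A ?S) = (\<Sum>q\<in>A. card (?S q))" by (rule card_SigmaI)
    also have "\<dots> = (\<Sum>q\<in>A. ?c)" by (rule sum.cong[OF refl], rule cS) (use A in blast)
    finally show ?thesis by simp
  qed
  note bij = bij_betw_merge_heavy[OF V ij, where d = d, folded e_def]
  from bij_betw_same_card[OF bij] show "card (ptrees V d) = ?c * card (ptrees V e)"
    unfolding cY[OF subset_refl] .
  let ?A = "{q \<in> ptrees V e. rank_bounded q h}" and ?X = "{p \<in> ptrees V d. rank_bounded p h}"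
  have "merge_heavy i j ` ?X \<subseteq> Sigma ?A ?S"
  proof
    fix y assume "y \<in> merge_heavy i j ` ?X"
    then obtain p where p: "p \<in> ptrees V d" "rank_bounded p h" "y = merge_heavy i j p" by blast
    then have "y \<in> Sigma (ptrees V e) ?S" using bij by (auto simp: bij_betw_def)
    moreover obtain f where "ranking p f" using p(1) by (auto simp: ptrees_def)
    then have "rank_bounded (fst y) h" unfolding p(3) using p(2) by (rule rank_bounded_merge_heavy)
    ultimately show "y \<in> Sigma ?A ?S" by auto
  qed
  moreover have "inj_on (merge_heavy i j) ?X"
    by (rule inj_on_subset[OF bij_betw_imp_inj_on[OF bij]]) blast
  moreover have "finite (Sigma ?A ?S)"
    using finite_ptrees[OF V(1), of e] fin by (intro finite_SigmaI) auto
  ultimately have "card ?X \<le> card (Sigma ?A ?S)" by (intro card_inj_on_le)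
  also have "\<dots> = ?c * card ?A" by (rule cY) blast
  finally show "card ?X \<le> ?c * card ?A" .
qed

section \<open>Existence of trees with given degrees\<close>

lemma ptrees_star:
  assumes V: "finite V" "r \<in> V" "d r + 1 = card V" "\<And>v. v \<in> V \<Longrightarrow> v \<noteq> r \<Longrightarrow> d v = 0"
  shows "ptrees V d \<noteq> {}"
proof -
  define p where "p w = (if w \<in> V - {r} then Some r else None)" for w
  have "ranking p (\<lambda>v. if v = r then 1 else 0)" by (auto simp: ranking_def p_def split: if_splits)
  moreover have "kids p v = (if v = r then V - {r} else {})" for v
    by (auto simp: kids_def p_def)
  ultimately have "p \<in> ptrees V d"
    using V by (auto simp: ptrees_def p_def dom_def ran_def split: if_splits)
  then show ?thesis by blast
qed

text \<open>Merging two inner vertices lowers the number of inner vertices, and the counting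
  identity has a positive factor, so existence passes back from the merged degrees. With at most one
  inner vertex there is a star.\<close>

lemma ptrees_nonempty:
  assumes V: "finite V" and "sum d V + 1 = card V"
  shows "ptrees V d \<noteq> {}"
  using assms(2)
proof (induction "card {v\<in>V. d v \<noteq> 0}" arbitrary: d rule: less_induct)
  case less
  show ?case
  proof (cases "\<exists>i\<in>V. \<exists>j\<in>V. i \<noteq> j \<and> d i \<noteq> 0 \<and> d j \<noteq> 0")
    case True
    then obtain i j where ij: "i \<in> V" "j \<in> V" "i \<noteq> j" "d i \<noteq> 0" "d j \<noteq> 0" by blast
    let ?e = "d(i := d i + d j, j := 0)"
    have sum: "sum f V = f i + (f j + sum f (V - {i} - {j}))" for f :: "'a \<Rightarrow> nat"
      using V ij by (simp add: sum.remove[of V i] sum.remove[of "V - {i}" j])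
    have "sum ?e (V - {i} - {j}) = sum d (V - {i} - {j})" by (intro sum.cong) auto
    then have "sum ?e V + 1 = card V" using less.prems ij(3) by (simp add: sum)
    moreover have "{v\<in>V. ?e v \<noteq> 0} \<subset> {v\<in>V. d v \<noteq> 0}" using ij by auto
    then have "card {v\<in>V. ?e v \<noteq> 0} < card {v\<in>V. d v \<noteq> 0}" using V by (intro psubset_card_mono) auto
    ultimately have "ptrees V ?e \<noteq> {}" using less.hyps by blast
    then have "card (ptrees V ?e) > 0" using finite_ptrees[OF V] by (simp add: card_gt_0_iff)
    then have "card (ptrees V d) > 0" using card_ptrees_merge(1)[OF V ij(1-3), of d] by simp
    then show ?thesis by (simp add: card_gt_0_iff)
  next
    case False
    have "V \<noteq> {}" using less.prems by auto
    \<comment> \<open>\<open>r\<close> is the inner vertex if there is one, and any vertex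
      otherwise.\<close>
    then obtain r where r: "r \<in> V" "\<And>v. v \<in> V \<Longrightarrow> v \<noteq> r \<Longrightarrow> d v = 0" using False by (metis ex_in_conv)
    then have "sum d V = d r" using V by (simp add: sum.remove[of V r])
    then show ?thesis using less.prems r V by (intro ptrees_star[of V r d]) auto
  qed
qed

section \<open>Distances\<close>

text \<open>Stepping to a predecessor one level lower must end at \<open>r\<close>. This serves both
  to bound distances and to prove connectedness.\<close>

lemma (in pair_wf_digraph) awalk_of_level:
  assumes "r \<in> pverts G"
    and pred: "\<And>v. v \<in> pverts G \<Longrightarrow> v \<noteq> r \<Longrightarrow> \<exists>u. (u, v) \<in> parcs G \<and> D v = Suc (D u)"
    and "v \<in> pverts G"
  shows "\<exists>p. awalk r p v \<and> length p + D r = D v"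
  using \<open>v \<in> pverts G\<close>
proof (induction "D v" arbitrary: v rule: less_induct)
  case less
  show ?case
  proof (cases "v = r")
    case True
    then show ?thesis using \<open>r \<in> pverts G\<close> by (intro exI[of _ "[]"]) (simp add: awalk_Nil_iff)
  next
    case False
    then obtain u where u: "(u, v) \<in> parcs G" "D v = Suc (D u)" using pred less.prems by blast
    then obtain p where p: "awalk r p u" "length p + D r = D u"
      using less.hyps[of u] in_arcsD1 by auto
    have "awalk u [(u, v)] v" using u(1) less.prems by (simp add: awalk_Cons_iff awalk_Nil_iff)
    then have "awalk r (p @ [(u, v)]) v" using p(1) by (rule awalk_appendI[rotated])
    then show ?thesis using p(2) u(2) by (intro exI[of _ "p @ [(u, v)]"]) simp
  qed
qed

lemma (in pair_wf_digraph) level_le_awalk: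
  assumes step: "\<And>u v. (u, v) \<in> parcs G \<Longrightarrow> D v \<le> Suc (D u)"
    and "awalk u p v"
  shows "D v \<le> D u + length p"
  using \<open>awalk u p v\<close>
proof (induction p arbitrary: u)
  case Nil
  then show ?case by (simp add: awalk_Nil_iff)
next
  case (Cons e p)
  then have e: "e \<in> parcs G" "fst e = u" "awalk (snd e) p v" by (auto simp: awalk_Cons_iff)
  then have "D (snd e) \<le> Suc (D u)" using step[of u "snd e"] by (cases e) auto
  with Cons.IH[OF e(3)] show ?case by simp
qed

lemma (in pair_wf_digraph) graph_dist_eq_level:
  assumes r: "r \<in> pverts G" "D r = 0"
    and step: "\<And>u v. (u, v) \<in> parcs G \<Longrightarrow> D v \<le> Suc (D u)"
    and pred: "\<And>v. v \<in> pverts G \<Longrightarrow> v \<noteq> r \<Longrightarrow> \<exists>u. (u, v) \<in> parcs G \<and> D v = Suc (D u)"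
    and v: "v \<in> pverts G"
  shows "graph_dist G r v = D v"
  unfolding graph_dist_def
proof (rule Least_equality)
  show "\<exists>p. awalk r p v \<and> length p = D v"
    using awalk_of_level[of r D, OF r(1) pred v] r(2) by simp
  show "D v \<le> k" if "\<exists>p. awalk r p v \<and> length p = k" for k
    using that level_le_awalk[of D, OF step] r(2) by fastforce
qed

lemma (in pair_wf_digraph)
  assumes "awalk r p v"
  shows graph_dist_le: "graph_dist G r v \<le> length p"
    and awalk_graph_dist: "\<exists>q. awalk r q v \<and> length q = graph_dist G r v"
proof -
  show "graph_dist G r v \<le> length p"
    unfolding graph_dist_def by (rule Least_le) (use assms in blast)
  show "\<exists>q. awalk r q v \<and> length q = graph_dist G r v"
    unfolding graph_dist_def by (rule LeastI_ex) (use assms in blast)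
qed

text \<open>The last arc of a shortest walk starts at a vertex one step closer to
  \<open>r\<close>.\<close>

lemma (in pair_wf_digraph) graph_dist_pred:
  assumes conn: "\<And>v. v \<in> pverts G \<Longrightarrow> \<exists>p. awalk r p v"
  shows "v \<in> pverts G \<Longrightarrow> v \<noteq> r \<Longrightarrow>
      \<exists>u. (u, v) \<in> parcs G \<and> graph_dist G r v = Suc (graph_dist G r u)"
proof -
  have le: "graph_dist G r v \<le> Suc (graph_dist G r u)" if uv: "(u, v) \<in> parcs G" for u v
  proof -
    obtain p where p: "awalk r p u" "length p = graph_dist G r u"
      using conn[OF in_arcsD1[OF uv]] awalk_graph_dist by blast
    have "awalk u [(u, v)] v" using uv in_arcsD2 by (simp add: awalk_Cons_iff awalk_Nil_iff)
    then have "awalk r (p @ [(u, v)]) v" using p(1) by (rule awalk_appendI[rotated])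
    from graph_dist_le[OF this] p(2) show ?thesis by simp
  qed
  assume v: "v \<in> pverts G" "v \<noteq> r"
  obtain p where p: "awalk r p v" "length p = graph_dist G r v"
    using conn[OF v(1)] awalk_graph_dist by blast
  then have "p \<noteq> []" using v(2) by (auto simp: awalk_Nil_iff)
  then obtain q e where qe: "p = q @ [e]" by (metis rev_exhaust)
  then have "awalk r q (fst e)" "e \<in> parcs G" "snd e = v"
    using p(1) by (auto simp: awalk_Cons_iff awalk_Nil_iff)
  moreover from this have "graph_dist G r (fst e) \<le> length q" "(fst e, v) \<in> parcs G"
    using graph_dist_le by (auto simp: prod_eq_iff)
  ultimately show "\<exists>u. (u, v) \<in> parcs G \<and> graph_dist G r v = Suc (graph_dist G r u)"
    using le[of "fst e" v] p(2) qe by (intro exI[of _ "fst e"]) auto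
qed

text \<open>\<open>connected\<close> refers to the symmetric closure, which leaves reachability
  unchanged in a symmetric graph; any two vertices are then joined through \<open>r\<close>.\<close>

lemma (in pair_graph) connected_iff:
  assumes "r \<in> pverts G"
  shows "Digraph_Component.connected G \<longleftrightarrow> (\<forall>v\<in>pverts G. \<exists>p. awalk r p v)"
proof
  assume "Digraph_Component.connected G"
  then have "r \<rightarrow>\<^sup>*\<^bsub>mk_symmetric G\<^esub> v" if "v \<in> pverts G" for v
    using assms that by (auto simp: connected_def strongly_connected_def)
  then show "\<forall>v\<in>pverts G. \<exists>p. awalk r p v"
    using reachable_mk_symmetric_eq[OF pair_sym_arcs] by (simp add: reachable_awalk)
next
  assume *: "\<forall>v\<in>pverts G. \<exists>p. awalk r p v"
  have "u \<rightarrow>\<^sup>*\<^bsub>mk_symmetric G\<^esub> v" if "u \<in> pverts G" "v \<in> pverts G" for u v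
  proof -
    have "r \<rightarrow>\<^sup>*\<^bsub>G\<^esub> u" "r \<rightarrow>\<^sup>*\<^bsub>G\<^esub> v" using * that by (simp_all add: reachable_awalk)
    then have "u \<rightarrow>\<^sup>*\<^bsub>G\<^esub> v" using symmetric_reachable'[of r u] reachable_trans by blast
    then show ?thesis using reachable_mk_symmetric_eq[OF pair_sym_arcs] by simp
  qed
  then show "Digraph_Component.connected G"
    using assms by (auto simp: connected_def strongly_connected_def)
qed

section \<open>Cycles\<close>

lemma pcas_nth: "pcas u c v \<Longrightarrow> Suc k < length c \<Longrightarrow> fst (c ! Suc k) = snd (c ! k)"
proof (induction c arbitrary: u k)
  case (Cons e c)
  show ?case
  proof (cases k)
    case 0
    then show ?thesis using Cons.prems by (cases c) auto
  next
    case (Suc k')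
    then show ?thesis using Cons by auto
  qed
qed simp

lemma pcas_last: "pcas u c v \<Longrightarrow> c \<noteq> [] \<Longrightarrow> snd (last c) = v"
  by (induction c arbitrary: u) (auto split: if_splits)

text \<open>At a vertex of maximal level on a cycle both neighbours are parents, hence equal.\<close>

lemma (in pair_wf_digraph) no_long_cycle:
  assumes arcs: "\<And>u v. (u, v) \<in> parcs G \<Longrightarrow> p u = Some v \<or> p v = Some u"
    and D: "\<And>u v. p u = Some v \<Longrightarrow> D v < (D u :: nat)"
    and c: "cycle c" "length c \<ge> 3"
  shows False
proof -
  obtain u where u: "awalk u c u" "distinct (tl (pawalk_verts u c))" "c \<noteq> []"
    using c(1) unfolding cycle_def by blast
  let ?m = "length c"
  \<comment> \<open>The vertices of the cycle are indexed periodically, so that every index has a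
    successor and, after adding a period, a predecessor.\<close>
  define t where "t k = snd (c ! (k mod ?m))" for k
  have cas: "pcas u c u" using u(1) by (simp add: awalk_def)
  then have "pawalk_verts u c = fst (hd c) # map snd c" using awalk_verts_conv'[of u c u] u(3) by simp
  then have dist: "distinct (map snd c)" using u(2) by simp
  have arc: "(t k, t (Suc k)) \<in> parcs G" for k
  proof -
    have k: "k mod ?m < ?m" "Suc k mod ?m < ?m" using u(3) by auto
    have "fst (c ! (Suc k mod ?m)) = t k"
    proof (cases "Suc (k mod ?m) = ?m")
      case True
      then have "k mod ?m = ?m - 1" by linarith
      then have "t k = snd (last c)" using u(3) by (simp add: t_def last_conv_nth)
      moreover have "Suc k mod ?m = 0" using True by (simp add: mod_Suc)
      moreover have "fst (c ! 0) = u" using cas u(3) by (cases c) auto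
      ultimately show ?thesis using pcas_last[OF cas u(3)] by simp
    next
      case False
      then have "Suc k mod ?m = Suc (k mod ?m)" by (simp add: mod_Suc)
      moreover have "Suc (k mod ?m) < ?m" using False k by linarith
      ultimately show ?thesis using pcas_nth[OF cas, of "k mod ?m"] by (simp add: t_def)
    qed
    moreover have "c ! (Suc k mod ?m) \<in> parcs G" using u(1) k by (auto simp: awalk_def)
    ultimately show ?thesis by (metis prod.collapse t_def)
  qed
  have "finite (range (D \<circ> t))"
    by (rule finite_subset[of _ "(\<lambda>k. D (snd (c ! k))) ` {..<?m}"]) (use u(3) in \<open>auto simp: t_def\<close>)
  then have "Max (range (D \<circ> t)) \<in> range (D \<circ> t)" by (intro Max_in) auto
  then obtain k where k: "D (t k) = Max (range (D \<circ> t))" by auto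
  have max: "D (t l) \<le> D (t k)" for l
    unfolding k by (rule Max_ge[OF \<open>finite _\<close>]) auto
  \<comment> \<open>This is the index before \<open>k\<close>, shifted by one period to stay valid
    for \<open>k = 0\<close>.\<close>
  define l where "l = k + ?m - 1"
  have l: "t (Suc l) = t k" using u(3) by (simp add: l_def t_def)
  have "p (t k) = Some (t (Suc k))" using arcs[OF arc[of k]] D max[of "Suc k"] by (metis not_less)
  moreover have "p (t k) = Some (t l)" using arcs[OF arc[of l]] D max[of l] l by (metis not_less)
  ultimately have "t (Suc k) = t l" by simp
  \<comment> \<open>Distinct vertices have distinct residues, so the indices after and before
    \<open>k\<close> agree modulo \<open>?m\<close>, and \<open>?m\<close> divides 2.\<close>
  then have "Suc k mod ?m = l mod ?m"
    using dist u(3) by (simp add: t_def distinct_conv_nth) (metis length_greater_0_conv mod_less_divisor)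
  then have "(Suc k + 1) mod ?m = Suc l mod ?m" by (metis Suc_eq_plus1 mod_Suc_eq)
  also have "Suc l = k + ?m" using u(3) by (simp add: l_def)
  finally have "(k + 2) mod ?m = k mod ?m" by simp
  then have "?m dvd 2" by (metis add_diff_cancel_left' le_add1 mod_eq_dvd_iff_nat)
  then show False using c(2) by (auto dest: dvd_imp_le)
qed

text \<open>An arc missing from the connected spanning subgraph \<open>H\<close> would close a path
  of \<open>H\<close> to a cycle. That path has at least two arcs, because loops are excluded and
  the arc itself is not in \<open>H\<close>.\<close>

lemma (in pair_graph) no_chord:
  assumes H: "pair_graph H" "pverts H = pverts G" "parcs H \<subseteq> parcs G" "Digraph_Component.connected H"
    and nc: "\<not> (\<exists>c. cycle c \<and> length c \<ge> 3)"
  shows "parcs G \<subseteq> parcs H"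
proof (rule subrelI, rule ccontr)
  interpret H: pair_graph H by fact
  fix u w assume uw: "(u, w) \<in> parcs G" "(u, w) \<notin> parcs H"
  have "u \<in> pverts H" "w \<in> pverts H" using uw(1) wellformed' H(2) by auto
  then have "u \<rightarrow>\<^sup>*\<^bsub>H\<^esub> w" using H.connected_iff[of u] H(4) by (simp add: H.reachable_awalk)
  then obtain p where p: "H.apath u p w" by (auto simp: H.reachable_apath)
  then have aw: "H.awalk u p w" and d: "distinct (pawalk_verts u p)" by (auto simp: H.apath_def)
  have "p \<noteq> []" using aw pair_no_loops[OF uw(1)] by (auto simp: H.awalk_Nil_iff)
  moreover have "p \<noteq> [e]" for e using aw uw(2) by (auto simp: H.awalk_Cons_iff H.awalk_Nil_iff)
  ultimately have "length p \<ge> 2" by (cases p rule: remdups_adj.cases) auto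
  have "(w, u) \<in> parcs G" using uw(1) pair_sym_arcs by (simp add: symmetric_def sym_def)
  have "awalk u p w" using aw H(2,3) by (auto simp: awalk_def H.awalk_def)
  moreover have "awalk w [(w, u)] u"
    using \<open>(w, u) \<in> parcs G\<close> in_arcsD2 by (simp add: awalk_Cons_iff awalk_Nil_iff)
  ultimately have "awalk u (p @ [(w, u)]) u" by (rule awalk_appendI)
  moreover have "distinct (tl (pawalk_verts u (p @ [(w, u)])))"
  proof -
    obtain e q where eq: "p = e # q" using \<open>p \<noteq> []\<close> by (cases p) auto
    have "fst e = u" using aw eq by (auto simp: H.awalk_def)
    have app: "pcas x q w \<Longrightarrow> pawalk_verts x (q @ [(w, u)]) = pawalk_verts x q @ [u]" for x
      by (induction q arbitrary: x) auto
    have "pcas (snd e) q w" using aw eq by (auto simp: H.awalk_def)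
    then show ?thesis using app d eq \<open>fst e = u\<close> by auto
  qed
  ultimately have "cycle (p @ [(w, u)])" unfolding cycle_def by blast
  moreover have "length (p @ [(w, u)]) \<ge> 3" using \<open>length p \<ge> 2\<close> by simp
  ultimately show False using nc by blast
qed

section \<open>Parent maps and rooted trees\<close>

text \<open>On a map without ranking, \<open>wfrec\<close> yields junk.\<close>

definition depth :: "('a \<Rightarrow> 'a option) \<Rightarrow> 'a \<Rightarrow> nat" where
  "depth p = wfrec {(v, w). p w = Some v}
     (\<lambda>D w. case p w of None \<Rightarrow> 0 | Some v \<Rightarrow> Suc (D v))"

definition root_of :: "'a set \<Rightarrow> ('a \<Rightarrow> 'a option) \<Rightarrow> 'a" where
  "root_of V p = (THE r. r \<in> V \<and> p r = None)"

definition graph_of :: "'a set \<Rightarrow> ('a \<Rightarrow> 'a option) \<Rightarrow> 'a pair_pre_digraph" where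
  "graph_of V p = \<lparr>pverts = V, parcs = {(v, w). p v = Some w \<or> p w = Some v}\<rparr>"

locale parent_map =
  fixes V :: "'a set" and d :: "'a \<Rightarrow> nat" and p
  assumes V: "finite V" and p: "p \<in> ptrees V d" and sum: "sum d V + 1 = card V"
begin

lemma in_V: "p w = Some v \<Longrightarrow> w \<in> V" "p w = Some v \<Longrightarrow> v \<in> V"
  using p by (auto simp: ptrees_def ran_def dom_def)

lemma depth_simps:
  "p v = None \<Longrightarrow> depth p v = 0"
  "p w = Some v \<Longrightarrow> depth p w = Suc (depth p v)"
proof -
  obtain f where f: "ranking p f" using p by (auto simp: ptrees_def)
  \<comment> \<open>The recursion moves to the parent, where ranks are larger, so the measure
    subtracts them from their maximum.\<close>
  have "{(v, w). p w = Some v} \<subseteq> Wellfounded.measure (\<lambda>v. Max (f ` V) - f v)"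
  proof clarify
    fix v w assume "p w = Some v"
    then have "f w < f v" "v \<in> V" using rankingD[OF f] in_V by auto
    moreover have "f v \<le> Max (f ` V)" using V \<open>v \<in> V\<close> by simp
    ultimately show "(v, w) \<in> Wellfounded.measure (\<lambda>v. Max (f ` V) - f v)" by simp
  qed
  then have wf: "wf {(v, w). p w = Some v}" using wf_measure wf_subset by blast
  have "depth p w = (case p w of None \<Rightarrow> 0 | Some v \<Rightarrow> Suc (depth p v))" for w
    unfolding depth_def by (subst wfrec[OF wf]) (auto simp: cut_def split: option.split)
  then show "p v = None \<Longrightarrow> depth p v = 0" "p w = Some v \<Longrightarrow> depth p w = Suc (depth p v)"
    by simp_all
qed

text \<open>Every vertex with a parent is counted once among the children of that parent, so there
  are \<open>sum d V\<close> of them, one fewer than \<open>card V\<close>.\<close>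

lemma ex1_root: "\<exists>!r. r \<in> V \<and> p r = None"
proof -
  have "dom p = (\<Union>v\<in>V. kids p v)" using in_V by (auto simp: kids_def)
  also have "card \<dots> = (\<Sum>v\<in>V. card (kids p v))"
    using V finite_kids[OF V p] by (intro card_UN_disjoint) (auto simp: kids_def)
  also have "\<dots> = sum d V" using p by (intro sum.cong) (auto simp: ptrees_def)
  finally have "card (dom p) + 1 = card V" using sum by simp
  moreover have "dom p \<subseteq> V" using in_V by auto
  moreover from this have "finite (dom p)" using V finite_subset by blast
  ultimately have "card (V - dom p) = 1" by (simp add: card_Diff_subset)
  then obtain r where "V - dom p = {r}" by (metis card_1_singletonE)
  then show ?thesis by (intro ex1I[of _ r]) auto
qed

lemma root: "root_of V p \<in> V" "p (root_of V p) = None" "v \<in> V \<Longrightarrow> p v = None \<Longrightarrow> v = root_of V p"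
  using theI'[OF ex1_root] ex1_root unfolding root_of_def by blast+

lemma pair_graph: "pair_graph (graph_of V p)"
proof
  obtain f where f: "ranking p f" using p by (auto simp: ptrees_def)
  show "finite (parcs (graph_of V p))"
    by (rule finite_subset[of _ "V \<times> V"]) (use V in_V in \<open>auto simp: graph_of_def\<close>)
  show "fst e \<noteq> snd e" if "e \<in> parcs (graph_of V p)" for e
  proof -
    have "p v \<noteq> Some v" for v using rankingD[OF f, of v v] by auto
    then show ?thesis using that by (auto simp: graph_of_def)
  qed
qed (use V in_V in \<open>auto simp: graph_of_def symmetric_def sym_def\<close>)

sublocale G: pair_graph "graph_of V p" by (rule pair_graph)

lemma graph_step: "(u, v) \<in> parcs (graph_of V p) \<Longrightarrow> depth p v \<le> Suc (depth p u)"
  by (auto simp: graph_of_def depth_simps)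

lemma graph_pred:
  assumes "v \<in> pverts (graph_of V p)" "v \<noteq> root_of V p"
  shows "\<exists>u. (u, v) \<in> parcs (graph_of V p) \<and> depth p v = Suc (depth p u)"
proof -
  obtain u where "p v = Some u" using assms root(3)[of v] by (auto simp: graph_of_def)
  then show ?thesis by (intro exI[of _ u]) (simp add: graph_of_def depth_simps)
qed

lemma graph_dist_eq: "v \<in> V \<Longrightarrow> graph_dist (graph_of V p) (root_of V p) v = depth p v"
  using root(1,2)
  by (intro G.graph_dist_eq_level graph_step graph_pred) (simp_all add: depth_simps graph_of_def)

lemma undirected_tree: "undirected_tree (graph_of V p)"
proof -
  have r: "root_of V p \<in> pverts (graph_of V p)" using root(1) by (simp add: graph_of_def)
  have "\<exists>c. G.awalk (root_of V p) c v" if "v \<in> pverts (graph_of V p)" for v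
  proof -
    have "\<exists>c. G.awalk (root_of V p) c v \<and> length c + depth p (root_of V p) = depth p v"
      using r graph_pred that by (intro G.awalk_of_level[where D = "depth p"])
    then show ?thesis by blast
  qed
  then have "Digraph_Component.connected (graph_of V p)"
    using G.connected_iff[OF r] by blast
  moreover have "\<not> (\<exists>c. G.cycle c \<and> length c \<ge> 3)"
  proof (rule notI, elim exE conjE)
    fix c assume c: "G.cycle c" "length c \<ge> 3"
    show False
    proof (rule G.no_long_cycle[of p "depth p" c])
      show "(u, v) \<in> parcs (graph_of V p) \<Longrightarrow> p u = Some v \<or> p v = Some u" for u v
        by (simp add: graph_of_def)
      show "p u = Some v \<Longrightarrow> depth p v < depth p u" for u v
        using depth_simps(2)[of u v] by simp
    qed (fact c)+
  qed
  ultimately show ?thesis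
    using pair_graph by (intro undirected_tree_def[THEN iffD2] conjI)
qed

text \<open>Ranks grow by at least one at each step to the root, so
  \<open>f v + depth p v \<le> h\<close>. Conversely \<open>h - depth p v\<close> is a ranking;
  depths of at most \<open>h\<close> keep the truncated subtraction strict.\<close>

lemma rank_bounded_iff_depth: "rank_bounded p h \<longleftrightarrow> (\<forall>v\<in>V. depth p v \<le> h)"
proof
  assume "rank_bounded p h"
  then obtain f where f: "ranking p f" "\<And>v. f v \<le> h" by (auto simp: rank_bounded_def)
  have "f v + depth p v \<le> h" for v
  proof (induction "depth p v" arbitrary: v)
    case (Suc k)
    then obtain u where u: "p v = Some u" using depth_simps(1)[of v] by fastforce
    then have "k = depth p u" using Suc.hyps(2) depth_simps(2) by simp
    with Suc.hyps(1) have "f u + depth p u \<le> h" by blast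
    then show ?case using rankingD[OF f(1) u] depth_simps(2)[OF u] by simp
  qed (use f(2) in simp)
  then show "\<forall>v\<in>V. depth p v \<le> h" using add_leD2 by blast
next
  assume *: "\<forall>v\<in>V. depth p v \<le> h"
  have "ranking p (\<lambda>v. h - depth p v)"
    unfolding ranking_def
  proof (intro allI impI)
    fix w v assume wv: "p w = Some v"
    then have "depth p w \<le> h" using * in_V by blast
    then show "h - depth p w < h - depth p v" using depth_simps(2)[OF wv] by simp
  qed
  then show "rank_bounded p h" unfolding rank_bounded_def by (intro exI[of _ "\<lambda>v. h - depth p v"]) simp
qed

end

definition tree_of :: "nat set \<Rightarrow> (nat \<Rightarrow> nat option) \<Rightarrow> rooted_tree" where
  "tree_of V p = (root_of V p, graph_of V p)"

lemma children_tree_of: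
  assumes "parent_map V d p" "v \<in> V"
  shows "children (tree_of V p) v = kids p v"
proof -
  interpret parent_map V d p by fact
  have "(p v = Some w \<or> p w = Some v) \<and>
      graph_dist (graph_of V p) (root_of V p) w = graph_dist (graph_of V p) (root_of V p) v + 1 \<longleftrightarrow>
      p w = Some v" for w
    using graph_dist_eq[OF \<open>v \<in> V\<close>] graph_dist_eq[of w] in_V(2)[of v w] in_V(1)[of w v]
      depth_simps(2)[of v w] depth_simps(2)[of w v] by auto
  then show ?thesis by (simp add: children_def tree_of_def kids_def graph_of_def)
qed

lemma height_tree_of:
  assumes "parent_map V d p"
  shows "height (tree_of V p) \<le> h \<longleftrightarrow> rank_bounded p h"
proof -
  interpret parent_map V d p by fact
  have "height (tree_of V p) = Max (depth p ` V)"
    using graph_dist_eq by (simp add: height_def tree_of_def graph_of_def cong: image_cong)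
  moreover have "finite (depth p ` V)" "depth p ` V \<noteq> {}" using V root(1) by auto
  ultimately show ?thesis by (simp add: rank_bounded_iff_depth)
qed

text \<open>For each vertex other than \<open>r\<close> choose a neighbour closer to
  \<open>r\<close>. The chosen arcs, taken in both directions, form a connected spanning subgraph,
  and by \<open>no_chord\<close> there are no others.\<close>

lemma rooted_tree_arc:
  assumes G: "undirected_tree G" and r: "r \<in> pverts G"
  obtains c where
    "\<And>v. v \<in> pverts G \<Longrightarrow> v \<noteq> r \<Longrightarrow> c v \<in> pverts G \<and> graph_dist G r v = Suc (graph_dist G r (c v))"
    "parcs G = {(v, w). v \<in> pverts G \<and> v \<noteq> r \<and> w = c v \<or> w \<in> pverts G \<and> w \<noteq> r \<and> v = c w}"
proof -
  interpret pair_graph G using G by (simp add: undirected_tree_def)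
  let ?D = "graph_dist G r"
  have conn: "\<And>v. v \<in> pverts G \<Longrightarrow> \<exists>p. awalk r p v"
    using G connected_iff[OF r] by (simp add: undirected_tree_def)
  obtain c where c: "\<And>v. v \<in> pverts G \<Longrightarrow> v \<noteq> r \<Longrightarrow> (c v, v) \<in> parcs G \<and> ?D v = Suc (?D (c v))"
    using graph_dist_pred[OF conn] by metis
  define A where "A = {(v, w). v \<in> pverts G \<and> v \<noteq> r \<and> w = c v \<or> w \<in> pverts G \<and> w \<noteq> r \<and> v = c w}"
  define H where "H = \<lparr>pverts = pverts G, parcs = A\<rparr>"
  have sub: "A \<subseteq> parcs G"
    using c pair_sym_arcs by (auto simp: A_def symmetric_def sym_def)
  interpret H: pair_graph H
  proof
    show "symmetric H" by (auto simp: H_def A_def symmetric_def sym_def)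
    show "finite (parcs H)" using finite_subset[OF sub pair_finite_arcs] by (simp add: H_def)
  qed (use sub pair_finite_verts pair_no_loops in_arcsD1 in_arcsD2 in \<open>auto simp: H_def\<close>)
  have rH: "r \<in> pverts H" using r by (simp add: H_def)
  have "\<exists>u. (u, v) \<in> parcs H \<and> ?D v = Suc (?D u)" if "v \<in> pverts H" "v \<noteq> r" for v
    using c that by (auto simp: H_def A_def)
  then have "\<exists>p. H.awalk r p v" if "v \<in> pverts H" for v
    using H.awalk_of_level[of r ?D v, OF rH _ that] by blast
  then have "Digraph_Component.connected H" unfolding H.connected_iff[OF rH] by blast
  then have "parcs G = A"
    using no_chord[OF H.pair_graph] sub G by (auto simp: H_def undirected_tree_def)
  moreover have "c v \<in> pverts G \<and> ?D v = Suc (?D (c v))" if "v \<in> pverts G" "v \<noteq> r" for v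
    using c[OF that] in_arcsD1 by blast
  ultimately show ?thesis using that unfolding A_def by blast
qed

text \<open>The sets of children can be read off the tree and determine \<open>p\<close>, which
  gives injectivity. For surjectivity the neighbour closer to the root from
  \<open>rooted_tree_arc\<close> is taken as parent.\<close>

lemma bij_betw_tree_of:
  assumes l: "l \<in> degree_sequences n"
  defines "d \<equiv> \<lambda>i. l ! (i - 1)"
  shows "bij_betw (tree_of {1..n}) (ptrees {1..n} d) (rooted_trees l)"
proof -
  let ?V = "{1..n}"
  have len: "length l = n" and "sum_list l + 1 = n" using l by (auto simp: degree_sequences_def)
  moreover have "sum d ?V = sum_list l"
    by (simp add: d_def sum_list_sum_nth len sum.atLeast1_atMost_eq atLeast0LessThan)
  ultimately have sum: "sum d ?V + 1 = card ?V" by simp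
  have pm: "parent_map ?V d p" if "p \<in> ptrees ?V d" for p
    using that sum by unfold_locales auto
  have "tree_of ?V p \<in> rooted_trees l" if p: "p \<in> ptrees ?V d" for p
  proof -
    interpret parent_map ?V d p using pm[OF p] .
    have "card (children (tree_of ?V p) v) = l ! (v - 1)" if "v \<in> ?V" for v
      using children_tree_of[OF pm[OF p] that] p that by (simp add: ptrees_def d_def)
    then show ?thesis
      using undirected_tree root(1) by (simp add: rooted_trees_def tree_of_def len graph_of_def)
  qed
  moreover have "inj_on (tree_of ?V) (ptrees ?V d)"
  proof (rule inj_onI, rule ext)
    fix p p' w assume *: "p \<in> ptrees ?V d" "p' \<in> ptrees ?V d" "tree_of ?V p = tree_of ?V p'"
    interpret p: parent_map ?V d p using pm[OF *(1)] .
    interpret p': parent_map ?V d p' using pm[OF *(2)] .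
    have "kids p v = kids p' v" if "v \<in> ?V" for v
      using children_tree_of[OF pm[OF *(1)] that] children_tree_of[OF pm[OF *(2)] that] *(3) by simp
    then have "p w = Some v \<longleftrightarrow> p' w = Some v" for v
      using p.in_V p'.in_V unfolding kids_def by blast
    then show "p w = p' w" by (metis option.exhaust)
  qed
  moreover have "T \<in> tree_of ?V ` ptrees ?V d" if T: "T \<in> rooted_trees l" for T
  proof -
    obtain r G where rG: "T = (r, G)" by (cases T)
    let ?D = "graph_dist G r"
    have G: "undirected_tree G" "pverts G = ?V" "r \<in> pverts G"
      "\<And>i. i \<in> ?V \<Longrightarrow> card (children (r, G) i) = d i"
      using T by (auto simp: rooted_trees_def rG len d_def)
    obtain c where c: "\<And>v. v \<in> pverts G \<Longrightarrow> v \<noteq> r \<Longrightarrow> c v \<in> pverts G \<and> ?D v = Suc (?D (c v))"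
      and arcs: "parcs G = {(v, w). v \<in> pverts G \<and> v \<noteq> r \<and> w = c v \<or> w \<in> pverts G \<and> w \<noteq> r \<and> v = c w}"
      by (rule rooted_tree_arc[OF G(1,3)]) (rule that)
    define p where "p w = (if w \<in> ?V \<and> w \<noteq> r then Some (c w) else None)" for w
    have Some: "p w = Some v \<longleftrightarrow> w \<in> ?V \<and> w \<noteq> r \<and> v = c w" for w v by (auto simp: p_def)
    have c1: "c v \<in> ?V" and c2: "?D v = Suc (?D (c v))" if "v \<in> ?V" "v \<noteq> r" for v
      using c[of v] that G(2) by simp_all
    have "kids p v = children (r, G) v" for v
    proof (rule set_eqI)
      fix w
      have "w \<in> ?V \<and> w \<noteq> r \<and> v = c w \<longleftrightarrow>
          (v \<in> ?V \<and> v \<noteq> r \<and> w = c v \<or> w \<in> ?V \<and> w \<noteq> r \<and> v = c w) \<and> ?D w = Suc (?D v)"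
        using c2[of v] c2[of w] by auto
      then show "w \<in> kids p v \<longleftrightarrow> w \<in> children (r, G) v"
        by (simp add: kids_def children_def arcs Some G(2))
    qed
    then have "card (kids p v) = d v" if "v \<in> ?V" for v using G(4)[OF that] by simp
    \<comment> \<open>Distance to the root falls towards the parent, so it is subtracted from its
      maximum.\<close>
    moreover have "ranking p (\<lambda>v. Max (?D ` ?V) - ?D v)"
      unfolding ranking_def
    proof (intro allI impI)
      fix w v assume "p w = Some v"
      then have w: "w \<in> ?V" "?D w = Suc (?D v)" using c2[of w] unfolding Some by simp_all
      from w(1) have "?D w \<le> Max (?D ` ?V)" by (intro Max_ge) auto
      then show "Max (?D ` ?V) - ?D w < Max (?D ` ?V) - ?D v" using w(2) by simp
    qed
    moreover have "dom p \<subseteq> ?V" "ran p \<subseteq> ?V"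
      using c1 unfolding dom_def ran_def by (auto simp: Some)
    ultimately have p: "p \<in> ptrees ?V d" by (auto simp: ptrees_def)
    interpret parent_map ?V d p using pm[OF p] .
    have "root_of ?V p = r" using root(3)[of r] G(2,3) by (simp add: p_def)
    moreover have "graph_of ?V p = G"
      using G(2) by (intro pair_pre_digraph.equality) (auto simp: graph_of_def arcs Some)
    ultimately show ?thesis using p by (auto simp: tree_of_def rG)
  qed
  ultimately show ?thesis unfolding bij_betw_def by blast
qed

section \<open>Comparison of the height distributions\<close>

definition height_cdf :: "nat list \<Rightarrow> nat \<Rightarrow> real" where
  "height_cdf l h = card {T \<in> rooted_trees l. height T \<le> h} / card (rooted_trees l)"

abbreviation degree_fun :: "nat list \<Rightarrow> nat \<Rightarrow> nat" where
  "degree_fun l \<equiv> \<lambda>i. l ! (i - 1)"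

lemma ptrees_cong: "(\<And>v. v \<in> V \<Longrightarrow> d v = e v) \<Longrightarrow> ptrees V d = ptrees V e"
  by (simp add: ptrees_def)

lemma sum_degree_fun:
  assumes "l \<in> degree_sequences n"
  shows "sum (degree_fun l) {1..n} + 1 = card {1..n}"
  using assms
  by (auto simp: degree_sequences_def sum_list_sum_nth sum.atLeast1_atMost_eq atLeast0LessThan)

lemma card_rooted_trees:
  assumes l: "l \<in> degree_sequences n"
  shows "card (rooted_trees l) = card (ptrees {1..n} (degree_fun l))"
    and "card {T \<in> rooted_trees l. height T \<le> h} = card {p \<in> ptrees {1..n} (degree_fun l). rank_bounded p h}"
    and "card (rooted_trees l) > 0"
proof -
  note bij = bij_betw_tree_of[OF l]
  show 1: "card (rooted_trees l) = card (ptrees {1..n} (degree_fun l))"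
    using bij_betw_same_card[OF bij] by simp
  have "parent_map {1..n} (degree_fun l) p" if "p \<in> ptrees {1..n} (degree_fun l)" for p
    using that sum_degree_fun[OF l] by unfold_locales auto
  then have "bij_betw (tree_of {1..n}) {p \<in> ptrees {1..n} (degree_fun l). rank_bounded p h}
      {T \<in> rooted_trees l. height T \<le> h}"
    by (intro bij_betw_Collect[OF bij] height_tree_of)
  from bij_betw_same_card[OF this]
  show "card {T \<in> rooted_trees l. height T \<le> h} = card {p \<in> ptrees {1..n} (degree_fun l). rank_bounded p h}"
    by simp
  show "card (rooted_trees l) > 0"
    unfolding 1 card_gt_0_iff
    using ptrees_nonempty[OF _ sum_degree_fun[OF l]] finite_ptrees[of "{1..n}"] by simp
qed

lemma height_cdf_perm_equiv:
  assumes "(x, y) \<in> perm_equiv n"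
  shows "height_cdf x h = height_cdf y h"
proof -
  from assms have x: "x \<in> degree_sequences n" and y: "y \<in> degree_sequences n"
    by (auto simp: perm_equiv_def)
  from assms obtain \<pi> where \<pi>: "\<pi> permutes {..<n}" "y = permute_list \<pi> x"
    by (auto simp: perm_equiv_def)
  have len: "length x = n" using x by (simp add: degree_sequences_def)
  \<comment> \<open>\<open>\<sigma>\<close> is \<open>\<pi>\<close> shifted from list positions to
    vertex labels, and the identity elsewhere.\<close>
  define \<sigma> where "\<sigma> i = (if i \<in> {1..n} then Suc (\<pi> (i - 1)) else i)" for i
  have in_range: "\<tau> (i - 1) < n" if "\<tau> permutes {..<n}" "i \<in> {1..n}" for \<tau> :: "nat \<Rightarrow> nat" and i
    using permutes_in_image[OF that(1), of "i - 1"] that(2) by auto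
  have "bij_betw \<sigma> {1..n} {1..n}"
  proof (rule bij_betwI[where g = "\<lambda>i. Suc (inv \<pi> (i - 1))"])
    show "\<sigma> \<in> {1..n} \<rightarrow> {1..n}" using in_range[OF \<pi>(1)] by (auto simp: \<sigma>_def Suc_le_eq)
    show "(\<lambda>i. Suc (inv \<pi> (i - 1))) \<in> {1..n} \<rightarrow> {1..n}"
      using in_range[OF permutes_inv[OF \<pi>(1)]] by (auto simp: Suc_le_eq)
    show "Suc (inv \<pi> (\<sigma> i - 1)) = i" if "i \<in> {1..n}" for i
      using that by (simp add: \<sigma>_def permutes_inverses[OF \<pi>(1)])
    show "\<sigma> (Suc (inv \<pi> (i - 1))) = i" if "i \<in> {1..n}" for i
      using that in_range[OF permutes_inv[OF \<pi>(1)] that]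
      by (simp add: \<sigma>_def permutes_inverses[OF \<pi>(1)] Suc_le_eq)
  qed
  then have \<sigma>: "\<sigma> permutes {1..n}" by (rule bij_imp_permutes) (auto simp: \<sigma>_def)
  have "degree_fun y i = (degree_fun x \<circ> \<sigma>) i" if "i \<in> {1..n}" for i
  proof -
    have "i - 1 < length x" using that len by auto
    with that \<pi>(1) len show ?thesis by (simp add: \<pi>(2) \<sigma>_def permute_list_nth)
  qed
  then have eq: "ptrees {1..n} (degree_fun y) = ptrees {1..n} (degree_fun x \<circ> \<sigma>)"
    by (intro ptrees_cong)
  note bij = bij_betw_relabel[OF \<sigma>, of "degree_fun x", folded eq]
  have "bij_betw (relabel \<sigma>) {p \<in> ptrees {1..n} (degree_fun y). rank_bounded p h}
      {p \<in> ptrees {1..n} (degree_fun x). rank_bounded p h}"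
    by (intro bij_betw_Collect[OF bij] rank_bounded_relabel permutes_bij[OF \<sigma>])
  then show ?thesis
    using bij_betw_same_card[OF bij]
    by (simp add: height_cdf_def card_rooted_trees[OF x] card_rooted_trees[OF y] bij_betw_same_card)
qed

text \<open>List positions 0 and 1 are the vertices 1 and 2. The same binomial coefficient relates
  the totals exactly and the bounded counts by an inequality, so it cancels in the quotient.\<close>

lemma height_cdf_merge:
  assumes x: "x \<in> degree_sequences n" and y: "y \<in> degree_sequences n"
    and pos: "x ! 0 \<ge> 1" "x ! 1 \<ge> 1"
    and eq: "y ! 0 = x ! 0 + x ! 1" "y ! 1 = 0" "\<forall>k\<in>{2..<n}. y ! k = x ! k"
  shows "height_cdf x h \<le> height_cdf y h"
proof -
  have n: "length x = n" "sum_list x + 1 = n" using x by (auto simp: degree_sequences_def)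
  then have "x ! 0 \<le> sum_list x" by (intro elem_le_sum_list) simp
  then have "n \<ge> 2" using pos n by linarith
  let ?d = "degree_fun x" and ?C = "x ! 0 + x ! 1 choose x ! 0"
  have "degree_fun y v = (?d(1 := ?d 1 + ?d 2, 2 := 0)) v" if "v \<in> {1..n}" for v
  proof -
    consider "v = 1" | "v = 2" | "v \<noteq> 1" "v \<noteq> 2" by blast
    then show ?thesis
    proof cases
      case 3
      then have "v - 1 \<in> {2..<n}" using \<open>v \<in> {1..n}\<close> by auto
      then have "y ! (v - 1) = x ! (v - 1)" using eq(3) by blast
      with 3 show ?thesis by simp
    qed (simp_all add: eq(1,2)[simplified])
  qed
  then have e: "ptrees {1..n} (degree_fun y) = ptrees {1..n} (?d(1 := ?d 1 + ?d 2, 2 := 0))"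
    by (rule ptrees_cong)
  have V: "finite {1..n}" "1 \<in> {1..n}" "2 \<in> {1..n}" "(1::nat) \<noteq> 2" using \<open>n \<ge> 2\<close> by auto
  have d12: "?d 1 = x ! 0" "?d 2 = x ! 1" by simp_all
  note card = card_ptrees_merge[OF V, of ?d, folded e, unfolded d12]
  have total: "card (rooted_trees x) = ?C * card (rooted_trees y)"
    unfolding card_rooted_trees(1)[OF x] card_rooted_trees(1)[OF y] by (rule card(1))
  have "card {T \<in> rooted_trees x. height T \<le> h} \<le> ?C * card {T \<in> rooted_trees y. height T \<le> h}"
    unfolding card_rooted_trees(2)[OF x] card_rooted_trees(2)[OF y] by (rule card(2))
  then have "real (card {T \<in> rooted_trees x. height T \<le> h}) \<le>
      real ?C * real (card {T \<in> rooted_trees y. height T \<le> h})"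
    by (simp only: of_nat_le_iff flip: of_nat_mult)
  then have "height_cdf x h \<le> (real ?C * real (card {T \<in> rooted_trees y. height T \<le> h})) /
      (real ?C * real (card (rooted_trees y)))"
    unfolding height_cdf_def total of_nat_mult by (intro divide_right_mono) simp_all
  then show ?thesis by (simp add: height_cdf_def)
qed

section \<open>From a single merge to classes and chains\<close>

lemma height_cdf_of_class:
  assumes "D \<in> degree_classes n" "x \<in> D" "y \<in> D"
  shows "x \<in> degree_sequences n" "height_cdf x h = height_cdf y h"
proof -
  obtain z where "D = perm_equiv n `` {z}" using assms(1) by (auto simp: degree_classes_def quotient_def)
  then have z: "(z, x) \<in> perm_equiv n" "(z, y) \<in> perm_equiv n" using assms(2,3) by auto
  then show "x \<in> degree_sequences n" by (auto simp: perm_equiv_def)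
  show "height_cdf x h = height_cdf y h" using z by (metis height_cdf_perm_equiv)
qed

lemma height_cdf_covers:
  assumes "covers n D D'" "x \<in> D" "y \<in> D'"
  shows "height_cdf x h \<le> height_cdf y h"
proof -
  obtain e e' where D: "D \<in> degree_classes n" "D' \<in> degree_classes n" "e \<in> D" "e' \<in> D'"
    and e: "e ! 0 \<ge> 1" "e ! 1 \<ge> 1" "e' ! 0 = e ! 0 + e ! 1" "e' ! 1 = 0"
      "\<forall>k\<in>{2..<n}. e' ! k = e ! k"
    using assms(1) unfolding covers_def by blast
  have "height_cdf x h = height_cdf e h" using height_cdf_of_class(2)[OF D(1) assms(2) D(3)] .
  also have "\<dots> \<le> height_cdf e' h"
    using height_cdf_of_class(1)[OF D(1,3,3)] height_cdf_of_class(1)[OF D(2,4,4)] e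
    by (rule height_cdf_merge)
  also have "\<dots> = height_cdf y h" using height_cdf_of_class(2)[OF D(2,4) assms(3)] .
  finally show ?thesis .
qed

lemma height_cdf_mono_prec2:
  assumes "prec2 n d' d"
  shows "height_cdf d h \<le> height_cdf d' h"
proof -
  obtain D D' where D: "d \<in> D" "d' \<in> D'" "(covers n)\<^sup>+\<^sup>+ D D'" using assms by (auto simp: prec2_def)
  \<comment> \<open>Quantifying over all representatives lets the links of the chain be joined at
    any member of the intermediate class.\<close>
  from D(3) have "\<forall>x\<in>D. \<forall>y\<in>D'. height_cdf x h \<le> height_cdf y h"
  proof induction
    case (base D')
    then show ?case using height_cdf_covers by blast
  next
    case (step D' D'')
    obtain e where "e \<in> D'" using step.hyps(2) by (auto simp: covers_def)
    then show ?case using step.IH height_cdf_covers[OF step.hyps(2)] order_trans by blast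
  qed
  with D(1,2) show ?thesis by blast
qed

text \<open>Heights are natural numbers, so only the floor of \<open>t\<close> matters. Negative
  \<open>t\<close> is separate because \<open>nat\<close> sends its floor to 0, where
  \<open>height_cdf\<close> may be positive.\<close>

lemma prob_height_le:
  assumes "l \<in> degree_sequences n"
  shows "measure (measure_pmf (pmf_of_set (rooted_trees l))) {T. real (height T) \<le> t} =
    (if t < 0 then 0 else height_cdf l (nat \<lfloor>t\<rfloor>))"
proof -
  have fin: "finite (rooted_trees l)" "rooted_trees l \<noteq> {}"
    using card_rooted_trees(3)[OF assms] by (auto simp: card_gt_0_iff)
  have "real m \<le> t \<longleftrightarrow> \<not> t < 0 \<and> m \<le> nat \<lfloor>t\<rfloor>" for m
  proof (cases "t < 0")
    case False
    then show ?thesis by (simp add: le_nat_iff le_floor_iff)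
  qed simp
  then have "{T. real (height T) \<le> t} = (if t < 0 then {} else {T. height T \<le> nat \<lfloor>t\<rfloor>})"
    by simp
  moreover have "rooted_trees l \<inter> {T. height T \<le> k} = {T \<in> rooted_trees l. height T \<le> k}" for k
    by blast
  ultimately show ?thesis using fin by (simp add: measure_pmf_of_set height_cdf_def)
qed

theorem corollary10:
  fixes n :: nat and d d' :: "nat list"
  assumes "d \<in> degree_sequences n" and "d' \<in> degree_sequences n"
    and "prec2 n d' d"
  shows "stoch_le (measure_pmf (pmf_of_set (rooted_trees d'))) (\<lambda>T. real (height T))
                  (measure_pmf (pmf_of_set (rooted_trees d))) (\<lambda>T. real (height T))"
  using height_cdf_mono_prec2[OF assms(3)]
  by (simp add: stoch_le_def prob_height_le[OF assms(1)] prob_height_le[OF assms(2)])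

end
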